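(* Let $p$ be a rational prime that splits in $\mathbb{Z}[i]$ as $p=\mathcal{P}\overline{\mathcal{P}}$, and let $I\in\{\mathcal{P},\overline{\mathcal{P}}\}$. Then $\mathbb{H}^3/\Gamma_1(I)$ contains no closed embedded totally geodesic surface. The same holds for $I=\langle 1+i\rangle$.
   Context: $\Gamma_1=\mathrm{PSL}(2,\mathbb{Z}[i])$, and for an ideal $I\subset\mathbb{Z}[i]$, $\Gamma_1(I)=\ker(\Gamma_1\to\mathrm{PSL}(2,\mathbb{Z}[i]/I))$ is the principal congruence subgroup. A "surface" means a quotient of $\mathbb{H}^2$ by a discrete group of isometries, possibly with torsion or orientation-reversing elements. For a finite-index subgroup $\Gamma<\Gamma_1$, totally geodesic surfaces in $\mathbb{H}^3/\Gamma$ correspond to $\Gamma$-orbits of circles/lines $\mathcal{C}$ with equation $a|z|^2+Bz+\bar B\bar z+c=0$, $a,c\in\mathbb{Z}$, $B\in\mathbb{Z}[i]$, $|B|^2-ac>0$; the surface is the image of the hyperbolic plane $H_{\mathcal{C}}$ bounded by $\mathcal{C}$, it is embedded if for all $\gamma\in\Gamma$, $\gamma H_{\mathcal{C}}=H_{\mathcal{C}}$ or $\gamma H_{\mathcal{C}}\cap H_{\mathcal{C}}=\emptyset$, and closed if compact. *)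

theory Defs
  imports "HOL-Analysis.Analysis"
begin

definition gauss_int :: "complex \<Rightarrow> bool" where
  "gauss_int z \<longleftrightarrow> Re z \<in> \<int> \<and> Im z \<in> \<int>"

definition gdvd :: "complex \<Rightarrow> complex \<Rightarrow> bool" where
  "gdvd g x \<longleftrightarrow> (\<exists>q. gauss_int q \<and> x = g * q)"

definition gcong :: "complex \<Rightarrow> complex \<Rightarrow> complex \<Rightarrow> bool" where
  "gcong g x y \<longleftrightarrow> gdvd g (x - y)"

text \<open>A rational prime p splits in Z[i] as p = P Pbar with P = <g>, Pbar = <cnj g>, P \<noteq> Pbar.\<close>
definition splits_as :: "nat \<Rightarrow> complex \<Rightarrow> bool" where
  "splits_as p g \<longleftrightarrow> prime p \<and> gauss_int g \<and> g * cnj g = of_nat p \<and> \<not> (gdvd g (cnj g) \<and> gdvd (cnj g) g)"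

text \<open>Matrices (a,b,c,d) = [[a,b],[c,d]]. Elements of PSL(2,Z[i]) are represented by
  their lifts in SL(2,Z[i]); +-M act identically on hyperbolic space.\<close>
type_synonym mat2 = "complex \<times> complex \<times> complex \<times> complex"

definition SL2Zi :: "mat2 set" where
  "SL2Zi = {(a,b,c,d). gauss_int a \<and> gauss_int b \<and> gauss_int c \<and> gauss_int d \<and> a*d - b*c = 1}"

text \<open>Principal congruence subgroup Gamma_1(<g>): kernel of PSL(2,Z[i]) -> PSL(2,Z[i]/<g>),
  i.e. lifts congruent to +-identity modulo <g>.\<close>
definition Gamma1 :: "complex \<Rightarrow> mat2 set" where
  "Gamma1 g = {(a,b,c,d). (a,b,c,d) \<in> SL2Zi \<and> gcong g b 0 \<and> gcong g c 0 \<and>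
      ((gcong g a 1 \<and> gcong g d 1) \<or> (gcong g a (-1) \<and> gcong g d (-1)))}"

definition H3 :: "(complex \<times> real) set" where
  "H3 = {(z,t). t > 0}"

text \<open>Action of SL(2,C) on the upper half-space (Poincare extension of Moebius maps).\<close>
definition mob :: "mat2 \<Rightarrow> complex \<times> real \<Rightarrow> complex \<times> real" where
  "mob M p = (case M of (a,b,c,d) \<Rightarrow> case p of (z,t) \<Rightarrow>
     (let den = (cmod (c*z + d))^2 + (cmod c)^2 * t^2 in
      (((a*z + b) * cnj (c*z + d) + a * cnj c * complex_of_real (t^2)) / complex_of_real den,
       t / den)))"

text \<open>Circle/line a|z|^2 + Bz + conj(B) conj(z) + c = 0 with a,c integers, B in Z[i],
  |B|^2 - ac > 0.\<close>
definition integral_circle :: "int \<Rightarrow> complex \<Rightarrow> int \<Rightarrow> bool" where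
  "integral_circle a B c \<longleftrightarrow> gauss_int B \<and> (cmod B)^2 - real_of_int (a*c) > 0"

text \<open>The hyperbolic plane H_C bounded by C: hemisphere / vertical half-plane over C.\<close>
definition hplane :: "int \<Rightarrow> complex \<Rightarrow> int \<Rightarrow> (complex \<times> real) set" where
  "hplane a B c = {(z,t). t > 0 \<and>
      real_of_int a * ((cmod z)^2 + t^2) + Re (B*z + cnj B * cnj z) + real_of_int c = 0}"

definition stabilizer :: "mat2 set \<Rightarrow> (complex \<times> real) set \<Rightarrow> mat2 set" where
  "stabilizer G H = {M \<in> G. mob M ` H = H}"

text \<open>The surface H_C/Stab_G(H_C) is embedded in H^3/G.\<close>
definition embedded_surface :: "mat2 set \<Rightarrow> (complex \<times> real) set \<Rightarrow> bool" where
  "embedded_surface G H \<longleftrightarrow> (\<forall>M\<in>G. mob M ` H = H \<or> mob M ` H \<inter> H = {})"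

text \<open>The surface H_C/Stab_G(H_C) is closed (compact): a compact subset of H_C
  whose translates under the stabilizer cover H_C.\<close>
definition closed_surface :: "mat2 set \<Rightarrow> (complex \<times> real) set \<Rightarrow> bool" where
  "closed_surface G H \<longleftrightarrow> (\<exists>K. compact K \<and> K \<subseteq> H \<and>
      H \<subseteq> (\<Union>M\<in>stabilizer G H. mob M ` K))"

definition no_closed_embedded_tg_surface :: "mat2 set \<Rightarrow> bool" where
  "no_closed_embedded_tg_surface G \<longleftrightarrow>
     (\<forall>a B c. integral_circle a B c \<longrightarrow>
        \<not> (embedded_surface G (hplane a B c) \<and> closed_surface G (hplane a B c)))"

end

theory Submission
  imports Defs
begin

text \<open>Write \<open>h(x, y) = a\<bar>x\<bar>\<^sup>2 + 2 Re (B x cnj y) + c\<bar>y\<bar>\<^sup>2\<close> and \<open>D = \<bar>B\<bar>\<^sup>2 - a c\<close> for a circle \<open>(a, B, c)\<close>, whose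
  radius is \<open>sqrt D / \<bar>a\<bar>\<close>. If the surface is closed then \<open>h\<close> has no nontrivial zero over the Gaussian
  integers. Some \<open>SL(2,Z[i])\<close>-translate of the circle has \<open>a\<^sup>2 < 2D\<close>, so it crosses its own translates
  by \<open>1\<close> and by \<open>1 + \<i>\<close>. The second translation settles the ideal \<open>\<langle>1 + \<i>\<rangle>\<close>.

  Now let \<open>p = g cnj g\<close> split, and suppose first that \<open>p\<close> does not divide \<open>D\<close>. A solution of
  \<open>x\<^sup>2 - D a\<^sup>2 p\<^bsup>2w\<^esup> y\<^sup>2 = 1\<close> with \<open>p\<close> not dividing \<open>y\<close> and \<open>w \<ge> K\<close>, weighted by \<open>g\<^bsup>2w\<^esup>\<close>, gives an element of the
  stabilizer of \<open>h\<close> that is congruent modulo \<open>g\<^bsup>K\<^esup>\<close> to a translation by an integer prime to \<open>p\<close>; a power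
  of it is congruent to the translation by \<open>1\<close>. Composing that power with the translation by \<open>-1\<close> gives
  an element of the congruence subgroup of level \<open>g\<^bsup>K\<^esup>\<close> that moves the circle by \<open>-1\<close>, so the surface is
  not embedded. If \<open>p\<close> divides \<open>D\<close>, a matrix of determinant \<open>g\<close> carries \<open>h\<close> to \<open>p h'\<close>, where \<open>h'\<close> has
  discriminant \<open>D / p\<close>; this raises the level from \<open>g\<^bsup>K\<^esup>\<close> to \<open>g\<^bsup>K+1\<^esup>\<close>, and one argues by induction on \<open>D\<close>.\<close>

section \<open>Pell's equation\<close>

text \<open>Dirichlet approximation gives infinitely many coprime pairs \<open>(h, k)\<close> with
  \<open>h\<^sup>2 - d * k\<^sup>2\<close> bounded. Two distinct pairs with the same value
  \<open>n\<close> that agree modulo \<open>n\<close> have a quotient of norm 1 with integral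
  coordinates.\<close>

lemma pell_solution:
  fixes d :: int
  assumes d: "d > 0" and nsq: "\<And>s. s\<^sup>2 \<noteq> d"
  obtains x y :: int where "x\<^sup>2 - d * y\<^sup>2 = 1" "y \<noteq> 0"
proof -
  define \<theta> where "\<theta> = sqrt (real_of_int d)"
  have th2: "\<theta>\<^sup>2 = d" and thpos: "\<theta> > 0"
    using d by (auto simp: \<theta>_def)
  have nz: "h\<^sup>2 - d * k\<^sup>2 \<noteq> 0" if "k \<noteq> 0" for h k :: int
  proof
    assume "h\<^sup>2 - d * k\<^sup>2 = 0"
    then have eq: "h\<^sup>2 = d * k\<^sup>2" by simp
    then have "k\<^sup>2 dvd h\<^sup>2" by simp
    then have "k dvd h" by simp
    then obtain s where "h = k * s" ..
    with eq have "s\<^sup>2 = d" using that by (simp add: power_mult_distrib)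
    then show False using nsq by blast
  qed
  have irr: "\<theta> \<notin> \<rat>"
  proof
    assume "\<theta> \<in> \<rat>"
    then obtain h k :: int where k: "k > 0" and e: "\<theta> = h / k"
      by (meson Rats_cases')
    then have "\<theta> * k = h" by simp
    then have "(\<theta> * k)\<^sup>2 = (real_of_int h)\<^sup>2" by simp
    then have "\<theta>\<^sup>2 * (real_of_int k)\<^sup>2 = (real_of_int h)\<^sup>2"
      by (simp only: power_mult_distrib)
    then have "real_of_int (d * k\<^sup>2) = real_of_int (h\<^sup>2)"
      unfolding th2 by simp
    then have "h\<^sup>2 - d * k\<^sup>2 = 0" by (simp only: of_int_eq_iff)
    then show False using nz k by auto
  qed
  define A where "A = approx_set \<theta>"
  have infA: "infinite A"
    using irr rational_iff_finite_approx_set A_def by blast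
  \<comment> \<open>Multiplying \<open>\<bar>h - k * \<theta>\<bar> < 1 / k\<close> by
    \<open>\<bar>h + k * \<theta>\<bar> \<le> k * (2 * \<theta> + 1)\<close> gives this bound on the
    norm.\<close>
  define C :: int where "C = \<lceil>2 * \<theta> + 1\<rceil>"
  define N where "N = (\<lambda>(h::int, k::int). h\<^sup>2 - d * k\<^sup>2)"
  have bound: "\<bar>N z\<bar> \<le> C \<and> snd z > 0 \<and> coprime (fst z) (snd z)" if "z \<in> A" for z
  proof -
    obtain h k where z: "z = (h, k)" by (cases z)
    have k: "k > 0" and cop: "coprime h k" and ap: "\<bar>\<theta> - h / k\<bar> < 1 / (real_of_int k)\<^sup>2"
      using that by (auto simp: A_def approx_set_def z)
    have kk: "real_of_int k \<ge> 1" using k by simp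
    have "\<bar>k * \<theta> - h\<bar> = k * \<bar>\<theta> - h / k\<bar>"
      using kk by (simp add: abs_mult_pos' right_diff_distrib)
    also have "\<dots> < k * (1 / (real_of_int k)\<^sup>2)"
      using ap kk by (intro mult_strict_left_mono) auto
    also have "\<dots> = 1 / k" using kk by (simp add: power2_eq_square)
    finally have 1: "\<bar>k * \<theta> - h\<bar> < 1 / k" .
    have "1 / real_of_int k \<le> 1" using kk by simp
    moreover have "k * \<theta> > 0" using kk thpos by simp
    ultimately have "\<bar>h + k * \<theta>\<bar> \<le> k + 2 * (k * \<theta>)" using 1 kk by linarith
    then have 2: "\<bar>h + k * \<theta>\<bar> \<le> k * (2 * \<theta> + 1)" by (simp add: algebra_simps)
    have "real_of_int \<bar>N z\<bar> = \<bar>h - k * \<theta>\<bar> * \<bar>h + k * \<theta>\<bar>"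
      by (simp add: N_def z abs_mult[symmetric] algebra_simps power2_eq_square th2[symmetric])
    also have "\<dots> \<le> (1 / k) * (k * (2 * \<theta> + 1))"
      using 1 2 kk by (intro mult_mono) auto
    also have "\<dots> = 2 * \<theta> + 1" using kk by simp
    finally have "\<bar>N z\<bar> \<le> C" unfolding C_def by linarith
    with k cop z show ?thesis by simp
  qed
  define F where "F = (\<lambda>z. (N z, fst z mod N z, snd z mod N z))"
  have "F ` A \<subseteq> {-C..C} \<times> {-C..C} \<times> {-C..C}"
  proof (rule image_subsetI)
    fix z assume "z \<in> A"
    note b = bound[OF this]
    then have n0: "N z \<noteq> 0" using nz[of "snd z" "fst z"] by (auto simp: N_def split: prod.splits)
    have "\<bar>u mod N z\<bar> \<le> C" for u
      using b n0 abs_mod_less[of "N z" u] by linarith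
    from this[of "fst z"] this[of "snd z"] b
    show "F z \<in> {-C..C} \<times> {-C..C} \<times> {-C..C}" by (auto simp: F_def)
  qed
  then have "finite (F ` A)" by (rule finite_subset) auto
  then obtain z0 where z0: "z0 \<in> A" and inf: "infinite {z \<in> A. F z = F z0}"
    using pigeonhole_infinite[OF infA] by blast
  have "\<not> {z \<in> A. F z = F z0} \<subseteq> {z0}"
    using inf finite_subset by blast
  then obtain z1 where z1: "z1 \<in> A" "F z1 = F z0" "z1 \<noteq> z0" by blast
  obtain h0 k0 h1 k1 where z: "z0 = (h0, k0)" "z1 = (h1, k1)" by (cases z0, cases z1)
  define n where "n = N z0"
  have n: "h0\<^sup>2 - d * k0\<^sup>2 = n" "h1\<^sup>2 - d * k1\<^sup>2 = n"
    and md: "h1 mod n = h0 mod n" "k1 mod n = k0 mod n"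
    using z1(2) by (auto simp: F_def N_def n_def z)
  have pos: "k0 > 0" "k1 > 0" and cop: "coprime h0 k0" "coprime h1 k1"
    using bound[OF z0] bound[OF z1(1)] z by auto
  have n0: "n \<noteq> 0" using nz[of k0 h0] n pos by auto
  obtain u v where u: "h1 = h0 + n * u" and v: "k1 = k0 + n * v"
    using md by (metis mod_eqE)
  \<comment> \<open>\<open>x - y * \<theta>\<close> is
    \<open>(h1 + k1 * \<theta>) / (h0 + k0 * \<theta>)\<close>; the congruences modulo
    \<open>n\<close> make its coordinates integers.\<close>
  define x where "x = 1 + h0 * u - d * k0 * v"
  define y where "y = u * k0 - h0 * v"
  have x: "n * x = h1 * h0 - d * k1 * k0"
    using n(1)[symmetric] u v by (simp add: x_def algebra_simps power2_eq_square)
  have y: "n * y = h1 * k0 - h0 * k1"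
    using u v by (simp add: y_def algebra_simps)
  have "n\<^sup>2 * (x\<^sup>2 - d * y\<^sup>2) = (n * x)\<^sup>2 - d * (n * y)\<^sup>2"
    by (simp add: algebra_simps power2_eq_square)
  also have "\<dots> = (h0\<^sup>2 - d * k0\<^sup>2) * (h1\<^sup>2 - d * k1\<^sup>2)"
    unfolding x y by (simp add: algebra_simps power2_eq_square)
  also have "\<dots> = n\<^sup>2" using n by (simp add: power2_eq_square)
  finally have "x\<^sup>2 - d * y\<^sup>2 = 1" using n0 by simp
  \<comment> \<open>If \<open>y = 0\<close>, the fractions \<open>h0 / k0\<close> and
    \<open>h1 / k1\<close> coincide; both are in lowest terms, so the two pairs would be
    equal.\<close>
  moreover have "y \<noteq> 0"
  proof
    assume "y = 0"
    with y have e: "h1 * k0 = h0 * k1" by simp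
    have "k0 dvd h0 * k1" unfolding e[symmetric] by simp
    then have a: "k0 dvd k1" using cop(1) by (simp add: coprime_commute coprime_dvd_mult_right_iff)
    have "k1 dvd h1 * k0" unfolding e by simp
    then have "k1 dvd k0" using cop(2) by (simp add: coprime_commute coprime_dvd_mult_right_iff)
    with a pos have "k0 = k1" by (simp add: zdvd_antisym_nonneg)
    with e pos z z1(3) show False by simp
  qed
  ultimately show thesis by (rule that)
qed

text \<open>Splitting the \<open>p\<close>-part off the second coordinate of an arbitrary solution costs only a
  larger power of \<open>p\<close> in the discriminant.\<close>
lemma pell_solution_coprime:
  fixes d :: int and p :: nat
  assumes d: "d > 0" and nsq: "\<And>s. s\<^sup>2 \<noteq> d" and p: "prime p"
  obtains x y :: int and w :: nat where "x\<^sup>2 - d * int p ^ (2 * w) * y\<^sup>2 = 1" "\<not> int p dvd y" "w \<ge> K"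
proof -
  have p0: "int p > 0" using p by (simp add: prime_gt_0_nat)
  have "d * int p ^ (2 * K) > 0" using d p0 by simp
  moreover have "s\<^sup>2 \<noteq> d * int p ^ (2 * K)" for s
  proof
    assume s: "s\<^sup>2 = d * int p ^ (2 * K)"
    then have s': "s\<^sup>2 = d * (int p ^ K)\<^sup>2" by (simp add: power_mult[symmetric] mult.commute)
    then have "(int p ^ K)\<^sup>2 dvd s\<^sup>2" by simp
    then have "int p ^ K dvd s" by simp
    then obtain t where "s = int p ^ K * t" ..
    with s' have "t\<^sup>2 = d" using p0 by (simp add: power_mult_distrib)
    then show False using nsq by blast
  qed
  ultimately obtain x y where xy: "x\<^sup>2 - d * int p ^ (2 * K) * y\<^sup>2 = 1" "y \<noteq> 0"
    by (rule pell_solution)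
  have "\<not> is_unit (int p)" using p by (auto simp: prime_nat_iff)
  then obtain y' where y': "y = int p ^ multiplicity (int p) y * y'" "\<not> int p dvd y'"
    using multiplicity_decompose'[OF xy(2)] by metis
  define e where "e = multiplicity (int p) y"
  have "x\<^sup>2 - d * int p ^ (2 * (K + e)) * y'\<^sup>2 = 1"
    using xy(1) y'(1) unfolding e_def[symmetric]
    by (simp add: power_mult_distrib power_add power_mult[symmetric] mult.commute mult.left_commute)
  then show thesis using that[of x "K + e" y'] y'(2) by simp
qed

section \<open>Hermitian forms and hyperbolic space\<close>

text \<open>Homogenization of the circle equation, which is recovered at \<open>y = 1\<close>.
  Moebius maps then act by linear substitution.\<close>

definition hform :: "real \<Rightarrow> complex \<Rightarrow> real \<Rightarrow> complex \<Rightarrow> complex \<Rightarrow> real" where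
  "hform a B c x y = a * (cmod x)\<^sup>2 + 2 * Re (B * x * cnj y) + c * (cmod y)\<^sup>2"

definition pull :: "mat2 \<Rightarrow> (complex \<Rightarrow> complex \<Rightarrow> real) \<Rightarrow> complex \<Rightarrow> complex \<Rightarrow> real" where
  "pull M f = (case M of (\<alpha>,\<beta>,\<gamma>,\<delta>) \<Rightarrow> \<lambda>x y. f (\<alpha> * x + \<beta> * y) (\<gamma> * x + \<delta> * y))"

definition mmul :: "mat2 \<Rightarrow> mat2 \<Rightarrow> mat2" where
  "mmul M N = (case M of (a,b,c,d) \<Rightarrow> case N of (a',b',c',d') \<Rightarrow>
     (a*a' + b*c', a*b' + b*d', c*a' + d*c', c*b' + d*d'))"

definition mdet :: "mat2 \<Rightarrow> complex" where
  "mdet M = (case M of (a,b,c,d) \<Rightarrow> a*d - b*c)"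

lemma pull_mmul: "pull (mmul M N) f = pull N (pull M f)"
  by (auto simp: pull_def mmul_def algebra_simps split: prod.splits)

text \<open>Without real parts, identities between forms become polynomial identities in the entries
  and their conjugates, which the simplifier can decide.\<close>

lemma hform_complex:
  fixes a c :: real and B x y :: complex
  shows "complex_of_real (hform a B c x y) =
    a * (x * cnj x) + B * x * cnj y + cnj B * cnj x * y + c * (y * cnj y)"
  by (simp add: hform_def complex_eq_iff cmod_power2, simp add: power2_eq_square algebra_simps)

lemma pull_hform:
  fixes a c :: real and B \<alpha> \<beta> \<gamma> \<delta> :: complex
  shows "pull (\<alpha>,\<beta>,\<gamma>,\<delta>) (hform a B c) =
   hform (hform a B c \<alpha> \<gamma>)
     (a * \<alpha> * cnj \<beta> + B * \<alpha> * cnj \<delta> + cnj B * cnj \<beta> * \<gamma> + c * \<gamma> * cnj \<delta>)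
     (hform a B c \<beta> \<delta>)"
proof (intro ext)
  fix x y
  have "complex_of_real (pull (\<alpha>,\<beta>,\<gamma>,\<delta>) (hform a B c) x y) = complex_of_real
   (hform (hform a B c \<alpha> \<gamma>)
     (a * \<alpha> * cnj \<beta> + B * \<alpha> * cnj \<delta> + cnj B * cnj \<beta> * \<gamma> + c * \<gamma> * cnj \<delta>)
     (hform a B c \<beta> \<delta>) x y)"
    unfolding pull_def prod.case hform_complex by (simp add: algebra_simps)
  then show "pull (\<alpha>,\<beta>,\<gamma>,\<delta>) (hform a B c) x y =
   hform (hform a B c \<alpha> \<gamma>)
     (a * \<alpha> * cnj \<beta> + B * \<alpha> * cnj \<delta> + cnj B * cnj \<beta> * \<gamma> + c * \<gamma> * cnj \<delta>)
     (hform a B c \<beta> \<delta>) x y" by (simp only: of_real_eq_iff)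
qed

text \<open>The discriminant is minus the determinant of the Hermitian matrix, and a substitution
  multiplies that determinant by the squared modulus of its own.\<close>

lemma hform_disc:
  fixes a c :: real and B \<alpha> \<beta> \<gamma> \<delta> :: complex
  shows "(cmod (a * \<alpha> * cnj \<beta> + B * \<alpha> * cnj \<delta> + cnj B * cnj \<beta> * \<gamma> + c * \<gamma> * cnj \<delta>))\<^sup>2
     - hform a B c \<alpha> \<gamma> * hform a B c \<beta> \<delta> = (cmod (\<alpha> * \<delta> - \<beta> * \<gamma>))\<^sup>2 * ((cmod B)\<^sup>2 - a * c)"
proof -
  have "complex_of_real ((cmod (a * \<alpha> * cnj \<beta> + B * \<alpha> * cnj \<delta> + cnj B * cnj \<beta> * \<gamma> + c * \<gamma> * cnj \<delta>))\<^sup>2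
     - hform a B c \<alpha> \<gamma> * hform a B c \<beta> \<delta>)
    = complex_of_real ((cmod (\<alpha> * \<delta> - \<beta> * \<gamma>))\<^sup>2 * ((cmod B)\<^sup>2 - a * c))"
    unfolding of_real_diff of_real_mult complex_norm_square hform_complex
    by (simp add: algebra_simps)
  then show ?thesis by (simp only: of_real_eq_iff)
qed

text \<open>A point \<open>q\<close> of hyperbolic space corresponds to the positive definite form \<open>qform q\<close>. Up to the factor
  \<open>snd q\<close>, \<open>hpol f q\<close> is the polar pairing of \<open>f\<close> with it, so the plane of \<open>f\<close> is the zero set of \<open>hpol f\<close>.\<close>
definition hpol :: "(complex \<Rightarrow> complex \<Rightarrow> real) \<Rightarrow> complex \<times> real \<Rightarrow> real" where
  "hpol f q = f (fst q) 1 + (snd q)\<^sup>2 * f 1 0"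

definition qform :: "complex \<times> real \<Rightarrow> complex \<Rightarrow> complex \<Rightarrow> real" where
  "qform q x y = ((cmod (x - y * fst q))\<^sup>2 + (cmod y)\<^sup>2 * (snd q)\<^sup>2) / snd q"

lemma hpol_hform:
  fixes a c t :: real and B z :: complex
  shows "hpol (hform a B c) (z, t) = a * ((cmod z)\<^sup>2 + t\<^sup>2) + 2 * Re (B * z) + c"
  by (simp add: hpol_def hform_def algebra_simps)

lemma hplane_iff: "q \<in> hplane a B c \<longleftrightarrow> q \<in> H3 \<and> hpol (hform a B c) q = 0"
  by (cases q) (auto simp: hplane_def H3_def hpol_hform algebra_simps)

text \<open>The Poincare extension for any nonzero determinant: the descent uses matrices of
  determinant \<open>g\<close>, whereas the formula of \<open>mob\<close> is the right one only for
  determinant 1.\<close>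

lemma mobius_point:
  assumes det: "mdet M \<noteq> 0" and q: "q \<in> H3"
  obtains q' r where "q' \<in> H3" "r > 0"
    "\<And>a B c. r * hpol (hform a B c) q' = hpol (pull M (hform a B c)) q"
    "\<And>x y. pull M (qform q') x y = cmod (mdet M) * qform q x y"
    "mdet M = 1 \<Longrightarrow> q' = mob M q"
proof -
  obtain \<alpha> \<beta> \<gamma> \<delta> where M: "M = (\<alpha>,\<beta>,\<gamma>,\<delta>)" by (cases M)
  obtain z t where zt: "q = (z, t)" "t > 0" using q by (auto simp: H3_def)
  define u where "u = \<alpha> * z + \<beta>"
  define v where "v = \<gamma> * z + \<delta>"
  define den where "den = (cmod v)\<^sup>2 + (cmod \<gamma>)\<^sup>2 * t\<^sup>2"
  define num where "num = u * cnj v + \<alpha> * cnj \<gamma> * t\<^sup>2"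
  define \<Delta> where "\<Delta> = mdet M"
  have \<Delta>: "u * \<gamma> - \<alpha> * v = - \<Delta>"
    by (simp add: u_def v_def \<Delta>_def mdet_def M algebra_simps)
  have den: "den > 0"
  proof (cases "\<gamma> = 0")
    case True
    then have "v \<noteq> 0" using det by (auto simp: v_def mdet_def M)
    then show ?thesis by (simp add: den_def add_pos_nonneg)
  next
    case False
    then show ?thesis using zt by (simp add: den_def add_nonneg_pos)
  qed
  \<comment> \<open>Lagrange's identity for the vectors \<open>(u, \<alpha> * t)\<close> and
    \<open>(v, \<gamma> * t)\<close>: \<open>num\<close> is their inner product, \<open>den\<close>
    the squared length of the second, and \<open>- \<Delta> * t\<close> their determinant.\<close>
  have lagrange: "(cmod num)\<^sup>2 + (cmod \<Delta>)\<^sup>2 * t\<^sup>2 = ((cmod u)\<^sup>2 + (cmod \<alpha>)\<^sup>2 * t\<^sup>2) * den"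
  proof -
    have \<Delta>2: "(cmod \<Delta>)\<^sup>2 = (cmod (u * \<gamma> - \<alpha> * v))\<^sup>2" by (simp add: \<Delta>)
    have "complex_of_real ((cmod num)\<^sup>2 + (cmod \<Delta>)\<^sup>2 * t\<^sup>2) =
      complex_of_real (((cmod u)\<^sup>2 + (cmod \<alpha>)\<^sup>2 * t\<^sup>2) * den)"
      unfolding \<Delta>2 den_def of_real_add of_real_mult complex_norm_square num_def
      by (simp add: algebra_simps of_real_power power2_eq_square)
    then show ?thesis by (simp only: of_real_eq_iff)
  qed
  define q' where "q' = (num / den, cmod \<Delta> * t / den)"
  show thesis
  proof (rule that)
    show "q' \<in> H3" using den det zt by (simp add: q'_def H3_def \<Delta>_def)
    show "den > 0" by (rule den)
    show "den * hpol (hform a B c) q' = hpol (pull M (hform a B c)) q" for a B c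
    proof -
      have "den * ((cmod (num / den))\<^sup>2 + (cmod \<Delta> * t / den)\<^sup>2)
          = ((cmod num)\<^sup>2 + (cmod \<Delta>)\<^sup>2 * t\<^sup>2) / den"
        using den by (simp add: norm_divide power_divide power_mult_distrib power2_eq_square field_simps)
      also have "\<dots> = (cmod u)\<^sup>2 + (cmod \<alpha>)\<^sup>2 * t\<^sup>2"
        unfolding lagrange using den by simp
      finally have 1: "den * ((cmod (num / den))\<^sup>2 + (cmod \<Delta> * t / den)\<^sup>2)
        = (cmod u)\<^sup>2 + (cmod \<alpha>)\<^sup>2 * t\<^sup>2" .
      have 2: "den * Re (B * (num / den)) = Re (B * num)"
        using den by (simp add: Re_divide_of_real)
      have "den * hpol (hform a B c) q' =
         a * (den * ((cmod (num / den))\<^sup>2 + (cmod \<Delta> * t / den)\<^sup>2)) + 2 * (den * Re (B * (num / den))) + c * den"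
        by (simp add: q'_def hpol_hform algebra_simps)
      also have "\<dots> = a * ((cmod u)\<^sup>2 + (cmod \<alpha>)\<^sup>2 * t\<^sup>2) + 2 * Re (B * num) + c * den"
        unfolding 1 2 ..
      also have "\<dots> = hform a B c u v + t\<^sup>2 * hform a B c \<alpha> \<gamma>"
        by (simp add: hform_def den_def num_def algebra_simps)
      also have "\<dots> = hpol (pull M (hform a B c)) q"
        by (simp add: hpol_def pull_def M zt u_def v_def)
      finally show ?thesis .
    qed
    show "pull M (qform q') x y = cmod (mdet M) * qform q x y" for x y
    proof -
      define X where "X = \<alpha> * x + \<beta> * y"
      define Y where "Y = \<gamma> * x + \<delta> * y"
      define m where "m = x - y * z"
      have X: "X = u * y + \<alpha> * m" and Y: "Y = v * y + \<gamma> * m"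
        by (simp_all add: X_def Y_def u_def v_def m_def algebra_simps)
      have "complex_of_real ((cmod (X * den - Y * num))\<^sup>2 + (cmod Y)\<^sup>2 * (cmod \<Delta>)\<^sup>2 * t\<^sup>2)
        = complex_of_real ((cmod \<Delta>)\<^sup>2 * den * ((cmod m)\<^sup>2 + (cmod y)\<^sup>2 * t\<^sup>2))"
      proof -
        have \<Delta>2: "(cmod \<Delta>)\<^sup>2 = (cmod (u * \<gamma> - \<alpha> * v))\<^sup>2" by (simp add: \<Delta>)
        show ?thesis
          unfolding \<Delta>2 den_def of_real_add of_real_mult complex_norm_square num_def X Y
          by (simp add: algebra_simps of_real_power power2_eq_square)
      qed
      then have key: "(cmod (X * den - Y * num))\<^sup>2 + (cmod Y)\<^sup>2 * (cmod \<Delta>)\<^sup>2 * t\<^sup>2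
        = (cmod \<Delta>)\<^sup>2 * den * ((cmod m)\<^sup>2 + (cmod y)\<^sup>2 * t\<^sup>2)"
        by (simp only: of_real_eq_iff)
      have "cmod (X - Y * (num / den)) = cmod (X * den - Y * num) / den"
      proof -
        have "X - Y * (num / den) = (X * den - Y * num) / den" using den by (simp add: field_simps)
        then show ?thesis using den by (simp add: norm_divide)
      qed
      then have "qform q' X Y = ((cmod (X * den - Y * num) / den)\<^sup>2 + (cmod Y)\<^sup>2 * (cmod \<Delta> * t / den)\<^sup>2)
           / (cmod \<Delta> * t / den)"
        by (simp add: qform_def q'_def)
      also have "\<dots> = ((cmod (X * den - Y * num))\<^sup>2 + (cmod Y)\<^sup>2 * (cmod \<Delta>)\<^sup>2 * t\<^sup>2)
           / (den * (cmod \<Delta> * t))"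
      proof -
        have "((E / r)\<^sup>2 + W * (s / r)\<^sup>2) / (s / r) = (E\<^sup>2 + W * s\<^sup>2) / (r * s)"
          if "r \<noteq> 0" for E r W s :: real
          using that by (cases "s = 0") (simp_all add: power2_eq_square field_simps)
        from this[of den _ _ "cmod \<Delta> * t"] den show ?thesis
          by (simp add: power_mult_distrib mult.assoc)
      qed
      also have "\<dots> = cmod (mdet M) * qform q x y"
      proof -
        have "k\<^sup>2 * r * e / (r * (k * t)) = k * (e / t)" if "r \<noteq> 0" for k r e :: real
          using that by (cases "k = 0") (simp_all add: power2_eq_square)
        from this[of den] den show ?thesis
          unfolding key by (simp add: qform_def zt m_def \<Delta>_def)
      qed
      finally show ?thesis by (simp add: M X_def Y_def pull_def)
    qed
    show "q' = mob M q" if "mdet M = 1"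
      using that by (simp add: q'_def mob_def M zt num_def den_def u_def v_def \<Delta>_def Let_def)
  qed
qed

section \<open>Gaussian integers and integral matrices\<close>

lemma gauss_int_simps [simp]:
  "gauss_int 0" "gauss_int 1" "gauss_int \<i>" "gauss_int (of_int n)" "gauss_int (of_nat m)"
  "gauss_int (numeral k)"
  by (auto simp: gauss_int_def)

lemma gauss_int_intros [intro!]:
  assumes "gauss_int x" "gauss_int y"
  shows "gauss_int (x + y)" "gauss_int (x - y)" "gauss_int (x * y)"
  using assms by (auto simp: gauss_int_def)

lemma gauss_int_intros1 [intro!]:
  assumes "gauss_int x"
  shows "gauss_int (- x)" "gauss_int (cnj x)" "gauss_int (x ^ n)"
proof -
  show "gauss_int (- x)" "gauss_int (cnj x)" using assms by (auto simp: gauss_int_def)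
  show "gauss_int (x ^ n)" by (induction n) (use assms in auto)
qed

lemma gauss_intE:
  assumes "gauss_int z"
  obtains m n :: int where "z = Complex m n"
  using assms by (auto simp: gauss_int_def elim!: Ints_cases) (metis complex_surj)

lemma gauss_int_norm_ge_1:
  assumes "gauss_int z" "z \<noteq> 0"
  shows "1 \<le> (cmod z)\<^sup>2"
proof -
  obtain m n :: int where z: "z = Complex m n" using assms(1) by (rule gauss_intE)
  have "m \<noteq> 0 \<or> n \<noteq> 0" using assms(2) z by (auto simp: complex_eq_iff)
  then have "m\<^sup>2 + n\<^sup>2 > 0" by (simp add: sum_power2_gt_zero_iff)
  then have "1 \<le> m\<^sup>2 + n\<^sup>2" by simp
  then have "1 \<le> real_of_int (m\<^sup>2 + n\<^sup>2)" by (simp only: of_int_1_le_iff)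
  then show ?thesis by (simp add: z cmod_power2)
qed

lemma mmul_mdet: "mdet (mmul M N) = mdet M * mdet N"
  by (auto simp: mdet_def mmul_def algebra_simps split: prod.splits)

lemma SL2Zi_mmul: "M \<in> SL2Zi \<Longrightarrow> N \<in> SL2Zi \<Longrightarrow> mmul M N \<in> SL2Zi"
  using mmul_mdet[of M N] by (auto simp: SL2Zi_def mdet_def mmul_def)

lemma SL2Zi_mdet: "M \<in> SL2Zi \<Longrightarrow> mdet M = 1"
  by (auto simp: SL2Zi_def mdet_def)

section \<open>Closed and embedded surfaces in terms of forms\<close>

definition anisotropic :: "(complex \<Rightarrow> complex \<Rightarrow> real) \<Rightarrow> bool" where
  "anisotropic f \<longleftrightarrow> (\<forall>x y. gauss_int x \<and> gauss_int y \<and> f x y = 0 \<longrightarrow> x = 0 \<and> y = 0)"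

lemma anisotropic_leading: "anisotropic f \<Longrightarrow> f 1 0 \<noteq> 0"
  unfolding anisotropic_def by (metis gauss_int_simps(1,2) zero_neq_one)

text \<open>Embeddedness in terms of forms: a plane that meets its preimage under \<open>N\<close>
  lies inside it. Since \<open>mob\<close> does not occur, the condition can be transported by
  matrices of any nonzero determinant.\<close>

definition separated :: "mat2 set \<Rightarrow> (complex \<Rightarrow> complex \<Rightarrow> real) \<Rightarrow> bool" where
  "separated G f \<longleftrightarrow> (\<forall>N\<in>G. (\<exists>q\<in>H3. hpol f q = 0 \<and> hpol (pull N f) q = 0) \<longrightarrow>
     (\<forall>q\<in>H3. hpol f q = 0 \<longrightarrow> hpol (pull N f) q = 0))"

lemma embedded_imp_separated:
  assumes G: "G \<subseteq> SL2Zi" and emb: "embedded_surface G (hplane a B c)"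
  shows "separated G (hform a B c)"
  unfolding separated_def
proof (intro ballI impI)
  fix N q
  assume N: "N \<in> G" and ex: "\<exists>q\<in>H3. hpol (hform a B c) q = 0 \<and> hpol (pull N (hform a B c)) q = 0"
    and q: "q \<in> H3" "hpol (hform a B c) q = 0"
  have det: "mdet N = 1" using N G SL2Zi_mdet by blast
  have mob: "mob N q \<in> hplane a B c \<longleftrightarrow> hpol (pull N (hform a B c)) q = 0" if q: "q \<in> H3" for q
  proof -
    obtain q' r where "q' \<in> H3" "r > 0" "r * hpol (hform a B c) q' = hpol (pull N (hform a B c)) q"
      "q' = mob N q"
      using mobius_point[of N q] det q by (metis zero_neq_one)
    then show ?thesis by (auto simp: hplane_iff)
  qed
  obtain q0 where "q0 \<in> hplane a B c" "mob N q0 \<in> hplane a B c"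
    using ex mob by (auto simp: hplane_iff)
  then have "mob N ` hplane a B c \<inter> hplane a B c \<noteq> {}" by blast
  then have "mob N ` hplane a B c = hplane a B c"
    using emb N by (auto simp: embedded_surface_def)
  then have "mob N q \<in> hplane a B c" using q hplane_iff by blast
  then show "hpol (pull N (hform a B c)) q = 0" using mob q by blast
qed

text \<open>As \<open>N' M = M N\<close>, the map \<open>M\<close> carries the planes of
  \<open>f\<close> and \<open>pull N f\<close> into those of the given form and its pullback by
  \<open>N'\<close>; the scalar \<open>s\<close> does not change zero sets.\<close>

lemma separated_conj:
  assumes sep: "separated G (hform a B c)" and det: "mdet M \<noteq> 0" and s: "s \<noteq> 0"
    and f: "\<And>x y. pull M (hform a B c) x y = s * f x y"
    and G: "\<And>N. N \<in> G' \<Longrightarrow> \<exists>N'\<in>G. mmul N' M = mmul M N"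
  shows "separated G' f"
  unfolding separated_def
proof (intro ballI impI)
  let ?h = "hform a B c"
  fix N q
  assume N: "N \<in> G'" and ex: "\<exists>q\<in>H3. hpol f q = 0 \<and> hpol (pull N f) q = 0"
    and q: "q \<in> H3" "hpol f q = 0"
  obtain N' where N': "N' \<in> G" "mmul N' M = mmul M N" using G[OF N] by blast
  have 1: "hpol (pull M ?h) q = s * hpol f q" for q
    by (simp add: hpol_def f algebra_simps)
  have "pull M (pull N' ?h) = pull N (pull M ?h)"
    by (simp add: N'(2) flip: pull_mmul)
  also have "\<dots> = (\<lambda>x y. s * pull N f x y)"
    by (intro ext) (cases N, simp add: pull_def f[unfolded pull_def])
  finally have 2: "hpol (pull M (pull N' ?h)) q = s * hpol (pull N f) q" for q
    by (simp add: hpol_def algebra_simps)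
  obtain a' B' c' where h': "pull N' ?h = hform a' B' c'"
    by (cases N') (metis pull_hform)
  have pt: "\<exists>q'\<in>H3. (hpol ?h q' = 0 \<longleftrightarrow> hpol f q = 0) \<and> (hpol (pull N' ?h) q' = 0 \<longleftrightarrow> hpol (pull N f) q = 0)"
    if q: "q \<in> H3" for q
  proof -
    obtain q' r where q': "q' \<in> H3" "r > 0" "\<And>a B c. r * hpol (hform a B c) q' = hpol (pull M (hform a B c)) q"
      using mobius_point[OF det q] by metis
    have "r * hpol ?h q' = s * hpol f q" "r * hpol (pull N' ?h) q' = s * hpol (pull N f) q"
      unfolding q'(3) 1 h' using 2[of q, unfolded h'] by simp_all
    then show ?thesis using q'(1,2) s by (intro bexI[of _ q']) (metis mult_eq_0_iff less_irrefl)+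
  qed
  have "\<exists>q\<in>H3. hpol ?h q = 0 \<and> hpol (pull N' ?h) q = 0"
    using ex pt by metis
  then have "\<forall>q\<in>H3. hpol ?h q = 0 \<longrightarrow> hpol (pull N' ?h) q = 0"
    using sep N'(1) by (auto simp: separated_def)
  then show "hpol (pull N f) q = 0" using pt[OF q(1)] q(2) by metis
qed

text \<open>\<open>1 / qform q x y\<close> is the height of \<open>q\<close> over the cusp \<open>x / y\<close>. On a compact set it is
  bounded uniformly over all cusps, whereas a plane whose boundary contains a cusp rises
  arbitrarily high over it.\<close>
lemma closed_surface_anisotropic:
  assumes G: "G \<subseteq> SL2Zi" and closed: "closed_surface G (hplane a B c)"
    and disc: "(cmod B)\<^sup>2 - real_of_int (a * c) > 0"
  shows "anisotropic (hform a B c)"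
  unfolding anisotropic_def
proof (intro allI impI, rule ccontr)
  let ?h = "hform a B c"
  fix x0 y0
  assume v0: "gauss_int x0 \<and> gauss_int y0 \<and> ?h x0 y0 = 0" and nz: "\<not> (x0 = 0 \<and> y0 = 0)"
  obtain K where K: "compact K" "K \<subseteq> hplane a B c"
    and cover: "hplane a B c \<subseteq> (\<Union>M\<in>stabilizer G (hplane a B c). mob M ` K)"
    using closed by (auto simp: closed_surface_def)
  have KH: "K \<subseteq> H3" using K(2) hplane_iff by blast
  have cK: "compact (snd ` K)" using K(1) by (intro compact_continuous_image continuous_intros)
  obtain \<epsilon> where \<epsilon>: "\<epsilon> > 0"
    and low: "\<And>q x y. q \<in> K \<Longrightarrow> gauss_int x \<Longrightarrow> gauss_int y \<Longrightarrow> \<not> (x = 0 \<and> y = 0) \<Longrightarrow> \<epsilon> \<le> qform q x y"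
  proof (cases "K = {}")
    case True
    then show thesis by (intro that[of 1]) auto
  next
    case False
    obtain q0 where q0: "q0 \<in> K" "\<And>q. q \<in> K \<Longrightarrow> snd q0 \<le> snd q"
      using compact_attains_inf[OF cK] False by auto
    obtain q1 where q1: "q1 \<in> K" "\<And>q. q \<in> K \<Longrightarrow> snd q \<le> snd q1"
      using compact_attains_sup[OF cK] False by auto
    have pos: "snd q > 0" if "q \<in> K" for q using that KH by (auto simp: H3_def)
    \<comment> \<open>The two bounds serve the two types of cusp: \<open>1 / snd q1\<close> the cusp
      at infinity, \<open>y = 0\<close>, and \<open>snd q0\<close> the finite ones.\<close>
    show thesis
    proof (rule that[of "min (snd q0) (1 / snd q1)"])
      show "0 < min (snd q0) (1 / snd q1)" using pos q0(1) q1(1) by simp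
      fix q x y assume q: "q \<in> K" and xy: "gauss_int x" "gauss_int y" "\<not> (x = 0 \<and> y = 0)"
      show "min (snd q0) (1 / snd q1) \<le> qform q x y"
      proof (cases "y = 0")
        case True
        then have "1 \<le> (cmod x)\<^sup>2" using xy gauss_int_norm_ge_1 by blast
        then have "1 / snd q1 \<le> (cmod x)\<^sup>2 / snd q"
          using pos[OF q] q1(2)[OF q] by (intro frac_le) auto
        then show ?thesis using True by (simp add: qform_def)
      next
        case False
        then have "1 \<le> (cmod y)\<^sup>2" using xy gauss_int_norm_ge_1 by blast
        then have "1 * (snd q)\<^sup>2 \<le> (cmod y)\<^sup>2 * (snd q)\<^sup>2"
          by (intro mult_right_mono) auto
        then have "(snd q)\<^sup>2 \<le> (cmod (x - y * fst q))\<^sup>2 + (cmod y)\<^sup>2 * (snd q)\<^sup>2"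
          by (simp add: add_increasing)
        then have "snd q \<le> qform q x y"
          using pos[OF q] by (simp add: qform_def field_simps power2_eq_square)
        then show ?thesis using q0(2)[OF q] by simp
      qed
    qed
  qed
  have all: "\<epsilon> \<le> qform q x0 y0" if q: "q \<in> hplane a B c" for q
  proof -
    obtain N k where N: "N \<in> G" and k: "k \<in> K" and qk: "q = mob N k"
      using q cover by (auto simp: stabilizer_def)
    obtain \<alpha> \<beta> \<gamma> \<delta> where N4: "N = (\<alpha>,\<beta>,\<gamma>,\<delta>)" by (cases N)
    have gi: "gauss_int \<alpha>" "gauss_int \<beta>" "gauss_int \<gamma>" "gauss_int \<delta>" and det: "\<alpha>*\<delta> - \<beta>*\<gamma> = 1"
      using N G by (auto simp: N4 SL2Zi_def)
    \<comment> \<open>\<open>(x, y)\<close> is the image of \<open>(x0, y0)\<close> under the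
      inverse of \<open>N\<close>. It is again a nonzero Gaussian vector, so the bound on
      \<open>K\<close> applies to it at \<open>k\<close>.\<close>
    define x where "x = \<delta> * x0 - \<beta> * y0"
    define y where "y = \<alpha> * y0 - \<gamma> * x0"
    have "\<alpha> * x + \<beta> * y = (\<alpha>*\<delta> - \<beta>*\<gamma>) * x0" "\<gamma> * x + \<delta> * y = (\<alpha>*\<delta> - \<beta>*\<gamma>) * y0"
      by (simp_all add: x_def y_def algebra_simps)
    then have e: "\<alpha> * x + \<beta> * y = x0" "\<gamma> * x + \<delta> * y = y0" by (simp_all add: det)
    have nz': "\<not> (x = 0 \<and> y = 0)" using e nz by auto
    have "mdet N = 1" by (simp add: mdet_def N4 det)
    then have "pull N (qform q) x y = qform k x y"
      using mobius_point[of N k] qk k KH by (metis mult_1 norm_one subsetD zero_neq_one)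
    then have "qform q x0 y0 = qform k x y" by (simp add: pull_def N4 e)
    then show ?thesis using low[OF k _ _ nz'] gi v0 by (auto simp: x_def y_def)
  qed
  \<comment> \<open>The first column is the isotropic vector, so \<open>M\<close> sends infinity to
    the cusp \<open>x0 / y0\<close> and the pulled-back plane is vertical.\<close>
  define M :: mat2 where "M = (if y0 = 0 then (x0, 0, 0, 1) else (x0, -1, y0, 0))"
  have det: "mdet M \<noteq> 0" using nz by (auto simp: M_def mdet_def)
  obtain B' c' where M: "pull M ?h = hform 0 B' c'" and B': "B' \<noteq> 0"
  proof -
    obtain \<beta> \<delta> where M4: "M = (x0, \<beta>, y0, \<delta>)" by (cases "y0 = 0") (auto simp: M_def)
    let ?B = "a * x0 * cnj \<beta> + B * x0 * cnj \<delta> + cnj B * cnj \<beta> * y0 + c * y0 * cnj \<delta>"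
    have "(cmod ?B)\<^sup>2 = (cmod (mdet M))\<^sup>2 * ((cmod B)\<^sup>2 - real_of_int (a * c))"
      using hform_disc[of a x0 \<beta> B \<delta> y0 c] v0 by (simp add: M4 mdet_def)
    moreover have "\<dots> > 0" using det disc by simp
    ultimately have "?B \<noteq> 0" by auto
    then show thesis using that[of ?B] pull_hform[of x0 \<beta> y0 \<delta> a B c] v0 by (simp add: M4)
  qed
  \<comment> \<open>The height makes the value of \<open>qform\<close> at \<open>(x0, y0)\<close>
    equal to \<open>\<epsilon> / 2\<close>; \<open>z\<close> is a point of the boundary line of the
    vertical plane.\<close>
  define t where "t = 2 * cmod (mdet M) / \<epsilon>"
  define z where "z = - c' * cnj B' / (2 * B' * cnj B')"
  have t: "t > 0" using det \<epsilon> by (simp add: t_def)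
  have "B' * z = - c' / 2" using B' by (simp add: z_def)
  then have "hpol (hform 0 B' c') (z, t) = 0" by (simp add: hpol_hform)
  moreover obtain q' r where q': "q' \<in> H3" "r > 0" "r * hpol ?h q' = hpol (pull M ?h) (z, t)"
    "pull M (qform q') 1 0 = cmod (mdet M) * qform (z, t) 1 0"
    using mobius_point[OF det, of "(z, t)"] t unfolding H3_def by (metis (mono_tags, lifting) mem_Collect_eq case_prodI)
  ultimately have "q' \<in> hplane a B c" using M by (simp add: hplane_iff)
  then have "\<epsilon> \<le> qform q' x0 y0" by (rule all)
  also have "qform q' x0 y0 = cmod (mdet M) / t"
    using q'(4) by (cases "y0 = 0") (simp_all add: M_def pull_def qform_def)
  also have "\<dots> = \<epsilon> / 2" using det \<epsilon> by (simp add: t_def)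
  finally show False using \<epsilon> by simp
qed

section \<open>Congruence subgroups\<close>

lemma gdvd_add [intro]: "gdvd g x \<Longrightarrow> gdvd g y \<Longrightarrow> gdvd g (x + y)"
  unfolding gdvd_def by (metis distrib_left gauss_int_intros(1))

lemma gdvd_minus [intro]: "gdvd g x \<Longrightarrow> gdvd g (- x)"
  unfolding gdvd_def by (metis mult_minus_right gauss_int_intros1(1))

lemma gdvd_diff [intro]: "gdvd g x \<Longrightarrow> gdvd g y \<Longrightarrow> gdvd g (x - y)"
  using gdvd_add[of g x "- y"] gdvd_minus by simp

lemma gdvd_mult_right: "gdvd g x \<Longrightarrow> gauss_int y \<Longrightarrow> gdvd g (x * y)"
  unfolding gdvd_def by (metis mult.assoc gauss_int_intros(3))

lemma gdvd_mult_left: "gdvd g x \<Longrightarrow> gauss_int y \<Longrightarrow> gdvd g (y * x)"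
  using gdvd_mult_right[of g x y] by (simp add: mult.commute)

lemma gdvd_triv: "gauss_int y \<Longrightarrow> gdvd g (g * y)"
  by (auto simp: gdvd_def)

lemma gdvd_trans: "gdvd g h \<Longrightarrow> gdvd h x \<Longrightarrow> gdvd g x"
  unfolding gdvd_def by (metis mult.assoc gauss_int_intros(3))

lemma gdvd_zero [simp]: "gdvd g 0"
  by (auto simp: gdvd_def intro!: exI[of _ 0])

lemma Gamma1_iff:
  "(a,b,c,d) \<in> Gamma1 g \<longleftrightarrow> (a,b,c,d) \<in> SL2Zi \<and> gdvd g b \<and> gdvd g c \<and>
     (\<exists>\<epsilon>\<in>{1,-1}. gdvd g (a - \<epsilon>) \<and> gdvd g (d - \<epsilon>))"
  by (auto simp: Gamma1_def gcong_def)

lemma Gamma1_subset: "Gamma1 g \<subseteq> SL2Zi"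
  by (auto simp: Gamma1_def)

text \<open>Normality in the shape that \<open>separated_conj\<close> expects. The conjugate by
  \<open>M\<close> is \<open>\<epsilon>\<close> plus the conjugate of \<open>N - \<epsilon>\<close>,
  and \<open>g\<close> divides all entries of \<open>N - \<epsilon>\<close>.\<close>

lemma Gamma1_normal:
  assumes N: "N \<in> Gamma1 g" and M: "M \<in> SL2Zi"
  shows "\<exists>N'\<in>Gamma1 g. mmul N' M = mmul M N"
proof -
  obtain \<alpha> \<beta> \<gamma> \<delta> where M4: "M = (\<alpha>,\<beta>,\<gamma>,\<delta>)" by (cases M)
  obtain a b c d where N4: "N = (a,b,c,d)" by (cases N)
  have gi: "gauss_int \<alpha>" "gauss_int \<beta>" "gauss_int \<gamma>" "gauss_int \<delta>" and det: "\<alpha>*\<delta> - \<beta>*\<gamma> = 1"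
    using M by (auto simp: M4 SL2Zi_def)
  obtain \<epsilon> where \<epsilon>: "\<epsilon> = 1 \<or> \<epsilon> = -1" and dv: "gdvd g b" "gdvd g c" "gdvd g (a - \<epsilon>)" "gdvd g (d - \<epsilon>)"
    and NS: "N \<in> SL2Zi"
    using N unfolding N4 Gamma1_iff by blast
  define W where "W = (\<delta>, -\<beta>, -\<gamma>, \<alpha>)"
  have "W \<in> SL2Zi" using gi det by (auto simp: W_def SL2Zi_def algebra_simps)
  then have S: "mmul (mmul M N) W \<in> SL2Zi" using M NS SL2Zi_mmul by blast
  have "mmul (mmul (mmul M N) W) M = mmul (mmul M N) (mmul W M)"
    by (auto simp: mmul_def algebra_simps split: prod.splits)
  also have "mmul W M = (1,0,0,1)"
    using det by (simp add: W_def M4 mmul_def algebra_simps)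
  finally have e: "mmul (mmul (mmul M N) W) M = mmul M N"
    by (auto simp: mmul_def split: prod.splits)
  define a' where "a' = a - \<epsilon>"
  define d' where "d' = d - \<epsilon>"
  have ad: "a = a' + \<epsilon>" "d = d' + \<epsilon>" by (simp_all add: a'_def d'_def)
  have dv': "gdvd g a'" "gdvd g d'" using dv by (simp_all add: a'_def d'_def)
  define X where "X = \<alpha>*\<delta>*a' + \<beta>*\<delta>*c - \<alpha>*\<gamma>*b - \<beta>*\<gamma>*d'"
  define Y where "Y = \<alpha>*\<alpha>*b + \<alpha>*\<beta>*d' - \<alpha>*\<beta>*a' - \<beta>*\<beta>*c"
  define Z where "Z = \<gamma>*\<delta>*a' + \<delta>*\<delta>*c - \<gamma>*\<gamma>*b - \<gamma>*\<delta>*d'"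
  define V where "V = \<gamma>*\<alpha>*b + \<alpha>*\<delta>*d' - \<beta>*\<gamma>*a' - \<beta>*\<delta>*c"
  have "mmul (mmul M N) W = (X + \<epsilon> * (\<alpha>*\<delta> - \<beta>*\<gamma>), Y, Z, V + \<epsilon> * (\<alpha>*\<delta> - \<beta>*\<gamma>))"
    by (simp add: W_def M4 N4 ad mmul_def X_def Y_def Z_def V_def algebra_simps)
  then have eq: "mmul (mmul M N) W = (X + \<epsilon>, Y, Z, V + \<epsilon>)" by (simp add: det)
  have "gdvd g X" "gdvd g Y" "gdvd g Z" "gdvd g V"
    unfolding X_def Y_def Z_def V_def using dv dv' gi
    by (auto intro!: gdvd_add gdvd_diff gdvd_mult_left)
  then have "mmul (mmul M N) W \<in> Gamma1 g"
    using S \<epsilon> unfolding eq Gamma1_iff by auto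
  then show ?thesis using e by blast
qed

section \<open>Integral forms\<close>

definition int_form :: "(complex \<Rightarrow> complex \<Rightarrow> real) \<Rightarrow> int \<Rightarrow> bool" where
  "int_form f D \<longleftrightarrow> (\<exists>(a::int) B (c::int). gauss_int B \<and> f = hform a B c \<and>
      real_of_int D = (cmod B)\<^sup>2 - real_of_int (a * c))"

lemma hform_Ints:
  assumes "gauss_int B" "gauss_int x" "gauss_int y"
  shows "hform (of_int a) B (of_int c) x y \<in> \<int>"
proof -
  have sq: "(cmod z)\<^sup>2 \<in> \<int>" if "gauss_int z" for z
    using that by (simp add: cmod_power2 gauss_int_def)
  have "Re (B * x * cnj y) \<in> \<int>" using assms by (auto simp: gauss_int_def)
  then show ?thesis using assms sq unfolding hform_def by (intro Ints_add Ints_mult) simp_all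
qed

lemma int_form_pull:
  assumes f: "int_form f D" and N: "N \<in> SL2Zi"
  shows "int_form (pull N f) D"
proof -
  obtain a c :: int and B where B: "gauss_int B" and fe: "f = hform a B c"
    and D: "real_of_int D = (cmod B)\<^sup>2 - real_of_int (a * c)"
    using f by (auto simp: int_form_def)
  obtain \<alpha> \<beta> \<gamma> \<delta> where N4: "N = (\<alpha>,\<beta>,\<gamma>,\<delta>)" by (cases N)
  have gi: "gauss_int \<alpha>" "gauss_int \<beta>" "gauss_int \<gamma>" "gauss_int \<delta>" and det: "\<alpha>*\<delta> - \<beta>*\<gamma> = 1"
    using N by (auto simp: N4 SL2Zi_def)
  obtain a' where a': "f \<alpha> \<gamma> = of_int a'" using hform_Ints[OF B gi(1,3)] fe by (metis Ints_cases)
  obtain c' where c': "f \<beta> \<delta> = of_int c'" using hform_Ints[OF B gi(2,4)] fe by (metis Ints_cases)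
  let ?B = "a * \<alpha> * cnj \<beta> + B * \<alpha> * cnj \<delta> + cnj B * cnj \<beta> * \<gamma> + c * \<gamma> * cnj \<delta>"
  have "real_of_int D = (cmod ?B)\<^sup>2 - real_of_int (a' * c')"
    using hform_disc[of a \<alpha> \<beta> B \<delta> \<gamma> c] det D by (simp add: a'[symmetric] c'[symmetric] fe)
  moreover have "gauss_int ?B" using gi B by (intro gauss_int_intros gauss_int_intros1) auto
  moreover have "pull N f = hform a' ?B c'"
    using pull_hform[of \<alpha> \<beta> \<gamma> \<delta> a B c] by (simp add: fe N4 a'[symmetric] c'[symmetric])
  ultimately show ?thesis by (auto simp: int_form_def)
qed

lemma anisotropic_pull:
  assumes f: "anisotropic f" and gi: "gauss_int \<alpha>" "gauss_int \<beta>" "gauss_int \<gamma>" "gauss_int \<delta>"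
    and det: "mdet (\<alpha>,\<beta>,\<gamma>,\<delta>) \<noteq> 0"
  shows "anisotropic (pull (\<alpha>,\<beta>,\<gamma>,\<delta>) f)"
  unfolding anisotropic_def
proof (intro allI impI)
  fix x y assume xy: "gauss_int x \<and> gauss_int y \<and> pull (\<alpha>,\<beta>,\<gamma>,\<delta>) f x y = 0"
  have "gauss_int (\<alpha> * x + \<beta> * y)" "gauss_int (\<gamma> * x + \<delta> * y)" using gi xy by auto
  then have z: "\<alpha> * x + \<beta> * y = 0" "\<gamma> * x + \<delta> * y = 0"
    using xy f unfolding anisotropic_def pull_def by auto
  have "(\<alpha>*\<delta> - \<beta>*\<gamma>) * x = \<delta> * (\<alpha> * x + \<beta> * y) - \<beta> * (\<gamma> * x + \<delta> * y)"
    "(\<alpha>*\<delta> - \<beta>*\<gamma>) * y = \<alpha> * (\<gamma> * x + \<delta> * y) - \<gamma> * (\<alpha> * x + \<beta> * y)"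
    by (simp_all add: algebra_simps)
  then have "mdet (\<alpha>,\<beta>,\<gamma>,\<delta>) * x = 0" "mdet (\<alpha>,\<beta>,\<gamma>,\<delta>) * y = 0"
    unfolding z by (simp_all add: mdet_def)
  then show "x = 0 \<and> y = 0" using det by simp
qed

lemma anisotropic_pull_SL2Zi:
  assumes "anisotropic f" "N \<in> SL2Zi"
  shows "anisotropic (pull N f)"
proof -
  obtain \<alpha> \<beta> \<gamma> \<delta> where N4: "N = (\<alpha>,\<beta>,\<gamma>,\<delta>)" by (cases N)
  show ?thesis
    using assms SL2Zi_mdet[OF assms(2)] unfolding N4 by (intro anisotropic_pull) (auto simp: SL2Zi_def)
qed

lemma separated_pull:
  assumes "separated (Gamma1 g) f" "int_form f D" "N \<in> SL2Zi"
  shows "separated (Gamma1 g) (pull N f)"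
proof -
  obtain a c :: int and B where fe: "f = hform a B c"
    using assms(2) by (auto simp: int_form_def)
  show ?thesis unfolding fe
    by (rule separated_conj[OF assms(1)[unfolded fe], of N 1])
       (use assms(3) SL2Zi_mdet Gamma1_normal in auto)
qed

text \<open>Take a representative whose leading coefficient is minimal in absolute value and translate
  its centre into the unit square around the origin. If \<open>2 * D \<le> a\<^sup>2\<close> then
  \<open>\<bar>a * c\<bar> = \<bar>\<bar>B\<bar>\<^sup>2 - D\<bar> \<le> a\<^sup>2 / 2\<close>, so \<open>c\<close> contradicts minimality.\<close>
lemma large_radius_representative:
  assumes f: "int_form f D" and an: "anisotropic f" and D: "D > 0"
  obtains N where "N \<in> SL2Zi" "(pull N f 1 0)\<^sup>2 < 2 * D"
proof -
  \<comment> \<open>The leading coefficients are integers, so the floor loses nothing; it only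
    supplies a natural number to minimize.\<close>
  define m where "m N = nat \<lfloor>\<bar>pull N f 1 0\<bar>\<rfloor>" for N
  have one: "(1,0,0,1) \<in> SL2Zi" by (simp add: SL2Zi_def)
  obtain N where N: "N \<in> SL2Zi" and min: "\<And>M. M \<in> SL2Zi \<Longrightarrow> m N \<le> m M"
    using ex_has_least_nat[of "\<lambda>N. N \<in> SL2Zi" "(1,0,0,1)" m] one by blast
  obtain a c :: int and B where B: "gauss_int B" and fe: "pull N f = hform a B c"
    and De: "real_of_int D = (cmod B)\<^sup>2 - real_of_int (a * c)"
    using int_form_pull[OF f N] by (auto simp: int_form_def)
  have "pull N f 1 0 \<noteq> 0"
    using anisotropic_leading[OF anisotropic_pull_SL2Zi[OF an N]] .
  then have a0: "a \<noteq> 0" by (simp add: fe hform_def)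
  have "(real_of_int a)\<^sup>2 < 2 * D"
  proof (rule ccontr)
    assume "\<not> ?thesis"
    then have ge: "2 * real_of_int D \<le> (real_of_int a)\<^sup>2" by simp
    \<comment> \<open>Translation by \<open>\<tau>\<close> replaces \<open>B\<close> by
      \<open>B + a * cnj \<tau>\<close>, whence the conjugate. The rounding leaves both parts of the
      new \<open>B\<close> at most \<open>\<bar>a\<bar> / 2\<close> in absolute value.\<close>
    define \<tau> where "\<tau> = cnj (- (Complex (round (Re B / a)) (round (Im B / a))))"
    have \<tau>: "gauss_int \<tau>" by (simp add: \<tau>_def gauss_int_def)
    have T: "(1,\<tau>,0,1) \<in> SL2Zi" using \<tau> by (simp add: SL2Zi_def)
    define B' where "B' = a * cnj \<tau> + B"
    obtain c' :: int where c': "hform a B c \<tau> 1 = c'"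
      using hform_Ints[OF B \<tau>, of 1 a c] by (auto elim: Ints_cases)
    have pT: "pull (1,\<tau>,0,1) (pull N f) = hform a B' c'"
      unfolding fe pull_hform c' by (simp add: B'_def hform_def)
    have De': "real_of_int D = (cmod B')\<^sup>2 - real_of_int a * real_of_int c'"
      using hform_disc[of a 1 \<tau> B 1 0 c] De unfolding c' by (simp add: B'_def hform_def)
    have half: "(u - a * round (u / a))\<^sup>2 \<le> (real_of_int a)\<^sup>2 / 4" for u :: real
    proof -
      have "\<bar>u / a - round (u / a)\<bar> \<le> 1 / 2"
        using of_int_round_abs_le[of "u / a"] by (simp add: abs_minus_commute)
      then have "\<bar>real_of_int a\<bar> * \<bar>u / a - round (u / a)\<bar> \<le> \<bar>real_of_int a\<bar> * (1 / 2)"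
        by (intro mult_left_mono) auto
      also have "\<bar>real_of_int a\<bar> * \<bar>u / a - round (u / a)\<bar> = \<bar>u - a * round (u / a)\<bar>"
        using a0 by (simp add: abs_mult[symmetric] right_diff_distrib)
      finally have "\<bar>u - a * round (u / a)\<bar>\<^sup>2 \<le> (\<bar>real_of_int a\<bar> * (1 / 2))\<^sup>2"
        by (intro power_mono) auto
      then show ?thesis by (simp add: power2_eq_square)
    qed
    have "(cmod B')\<^sup>2 = (Re B - a * round (Re B / a))\<^sup>2 + (Im B - a * round (Im B / a))\<^sup>2"
      by (simp add: B'_def \<tau>_def cmod_power2 algebra_simps)
    also have "\<dots> \<le> (real_of_int a)\<^sup>2 / 2"
      using half[of "Re B"] half[of "Im B"] by simp
    finally have B': "(cmod B')\<^sup>2 \<le> (real_of_int a)\<^sup>2 / 2" .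
    have ac: "\<bar>real_of_int a * real_of_int c'\<bar> \<le> (real_of_int a)\<^sup>2 / 2"
    proof -
      have "real_of_int D > 0" "(cmod B')\<^sup>2 \<ge> 0" using D by simp_all
      then show ?thesis using De' B' ge by linarith
    qed
    \<comment> \<open>\<open>J\<close> exchanges the outer coefficients, so \<open>c'\<close>
      becomes a leading coefficient and minimality applies to it.\<close>
    define J :: mat2 where "J = (0,-1,1,0)"
    have J: "J \<in> SL2Zi" by (auto simp: J_def SL2Zi_def)
    define M where "M = mmul (mmul N (1,\<tau>,0,1)) J"
    have "M \<in> SL2Zi" unfolding M_def using N T J SL2Zi_mmul by blast
    moreover have "pull M f 1 0 = c'"
      unfolding M_def pull_mmul pT by (simp add: J_def pull_def hform_def)
    ultimately have "nat \<lfloor>\<bar>real_of_int a\<bar>\<rfloor> \<le> nat \<lfloor>\<bar>real_of_int c'\<bar>\<rfloor>"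
      using min[of M] by (simp add: m_def fe hform_def)
    then have "\<bar>a\<bar> \<le> \<bar>c'\<bar>" by (simp flip: of_int_abs)
    then have "\<bar>real_of_int a\<bar> * \<bar>real_of_int a\<bar> \<le> \<bar>real_of_int a\<bar> * \<bar>real_of_int c'\<bar>"
      by (intro mult_left_mono) auto
    then have "(real_of_int a)\<^sup>2 \<le> \<bar>real_of_int a * real_of_int c'\<bar>"
      by (simp add: power2_eq_square abs_mult)
    moreover have "(real_of_int a)\<^sup>2 > 0" using a0 by simp
    ultimately show False using ac by linarith
  qed
  then show thesis by (intro that[OF N]) (simp add: fe hform_def)
qed

section \<open>Hemispheres that meet their translates\<close>

lemma hpol_centre:
  fixes a c t :: real and B z :: complex
  shows "a * hpol (hform a B c) (z, t) = (cmod (a * z + cnj B))\<^sup>2 + a\<^sup>2 * t\<^sup>2 - ((cmod B)\<^sup>2 - a * c)"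
  unfolding hpol_hform cmod_power2 by (simp add: power2_eq_square algebra_simps)

text \<open>Two equal hemispheres whose centres are less than a diameter apart meet without
  coinciding. Only the pullback by \<open>N\<close> has to agree with that of a translation, so
  \<open>N\<close> may differ from it by a stabilizer of the form.\<close>

lemma separated_translation_bound:
  assumes sep: "separated G (hform a B c)" and N: "N \<in> G"
    and pN: "pull N (hform a B c) = pull (1,\<tau>,0,1) (hform a B c)"
    and a: "a \<noteq> 0" and \<tau>: "\<tau> \<noteq> 0" and D: "D = (cmod B)\<^sup>2 - a * c" "D > 0"
  shows "4 * D \<le> (cmod \<tau>)\<^sup>2 * a\<^sup>2"
proof (rule ccontr)
  assume "\<not> ?thesis"
  then have lt: "(cmod \<tau>)\<^sup>2 * a\<^sup>2 < 4 * D" by simp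
  let ?f = "hform a B c"
  have sh: "hpol (pull N ?f) (z, t) = hpol ?f (z + \<tau>, t)" for z t
    unfolding pN by (simp add: hpol_def pull_def)
  have iff: "hpol ?f (z, t) = 0 \<longleftrightarrow> (cmod (a * z + cnj B))\<^sup>2 + a\<^sup>2 * t\<^sup>2 = D"
    for z :: complex and t :: real
    using hpol_centre[of a B c z t] a D by auto
  define \<zeta> where "\<zeta> = - cnj B / a"
  have \<zeta>: "a * \<zeta> + cnj B = 0" using a by (simp add: \<zeta>_def)
  have \<zeta>w: "a * (\<zeta> + w) + cnj B = a * w" for w :: complex using \<zeta> by (simp add: distrib_left)
  \<comment> \<open>The squared height of the common point above the midpoint of the centres
    \<open>\<zeta>\<close> and \<open>\<zeta> - \<tau>\<close>.\<close>
  define s where "s = D / a\<^sup>2 - (cmod \<tau>)\<^sup>2 / 4"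
  have s: "s > 0" using lt a by (simp add: s_def field_simps)
  have as: "a\<^sup>2 * s = D - (cmod \<tau>)\<^sup>2 * a\<^sup>2 / 4" using a by (simp add: s_def field_simps)
  have "(\<zeta> + (- \<tau> / 2), sqrt s) \<in> H3" using s by (simp add: H3_def)
  moreover have "hpol ?f (\<zeta> + (- \<tau> / 2), sqrt s) = 0"
    using iff[of "\<zeta> + (- \<tau> / 2)" "sqrt s"] \<zeta>w[of "- \<tau> / 2"] s as
    by (simp add: norm_mult norm_divide power_mult_distrib power_divide del: add_uminus_conv_diff)
  moreover have "hpol (pull N ?f) (\<zeta> + (- \<tau> / 2), sqrt s) = 0"
  proof -
    have e: "\<zeta> + (- \<tau> / 2) + \<tau> = \<zeta> + \<tau> / 2" by simp
    show ?thesis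
      unfolding sh e using iff[of "\<zeta> + \<tau> / 2" "sqrt s"] \<zeta>w[of "\<tau> / 2"] s as
      by (simp add: norm_mult norm_divide power_mult_distrib power_divide)
  qed
  ultimately have all: "\<forall>q\<in>H3. hpol ?f q = 0 \<longrightarrow> hpol (pull N ?f) q = 0"
    using sep N unfolding separated_def by blast
  \<comment> \<open>The apex of the first hemisphere does not lie on the second.\<close>
  have "(\<zeta> + 0, sqrt D / \<bar>a\<bar>) \<in> H3" using D a by (simp add: H3_def)
  moreover have r: "a\<^sup>2 * (sqrt D / \<bar>a\<bar>)\<^sup>2 = D" using D a by (simp add: power_divide)
  then have "hpol ?f (\<zeta> + 0, sqrt D / \<bar>a\<bar>) = 0" unfolding iff \<zeta>w by simp
  ultimately have "hpol (pull N ?f) (\<zeta> + 0, sqrt D / \<bar>a\<bar>) = 0" using all by blast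
  then have "(cmod (a * \<tau>))\<^sup>2 + D = D" unfolding sh iff by (simp add: \<zeta>w r)
  then show False using a \<tau> by simp
qed

lemma integral_circle_int_form:
  assumes "integral_circle a B c"
  obtains D where "int_form (hform a B c) D" "D > 0"
proof -
  have "(cmod B)\<^sup>2 \<in> \<int>" using assms by (simp add: integral_circle_def cmod_power2 gauss_int_def)
  then have "(cmod B)\<^sup>2 - real_of_int (a * c) \<in> \<int>" by (intro Ints_diff) auto
  then obtain D where D: "(cmod B)\<^sup>2 - real_of_int (a * c) = real_of_int D" by (rule Ints_cases)
  then have "int_form (hform a B c) D" unfolding int_form_def
    using assms by (intro exI[of _ a] exI[of _ B] exI[of _ c]) (simp add: integral_circle_def)
  moreover have "D > 0" using assms D by (simp add: integral_circle_def)
  ultimately show thesis by (rule that)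
qed

text \<open>Translation by \<open>g\<close> lies in the group and has length \<open>sqrt 2\<close>,
  while \<open>a\<^sup>2 < 2 * D\<close> makes the diameter exceed \<open>sqrt 2\<close>.\<close>

lemma no_surface_norm_2:
  assumes g: "gauss_int g" "(cmod g)\<^sup>2 = 2"
  shows "no_closed_embedded_tg_surface (Gamma1 g)"
  unfolding no_closed_embedded_tg_surface_def
proof (intro allI impI notI)
  fix a c :: int and B
  assume ic: "integral_circle a B c"
    and ec: "embedded_surface (Gamma1 g) (hplane a B c) \<and> closed_surface (Gamma1 g) (hplane a B c)"
  let ?f = "hform a B c"
  have sep: "separated (Gamma1 g) ?f" using ec embedded_imp_separated Gamma1_subset by blast
  have an: "anisotropic ?f"
    using closed_surface_anisotropic[OF Gamma1_subset] ec ic by (auto simp: integral_circle_def)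
  obtain D where f: "int_form ?f D" and D0: "D > 0"
    using integral_circle_int_form[OF ic] .
  obtain N where N: "N \<in> SL2Zi" "(pull N ?f 1 0)\<^sup>2 < 2 * D"
    using large_radius_representative[OF f an D0] .
  obtain a' c' :: int and B' where fe: "pull N ?f = hform a' B' c'"
    and De: "real_of_int D = (cmod B')\<^sup>2 - real_of_int (a' * c')"
    using int_form_pull[OF f N(1)] by (auto simp: int_form_def)
  have "pull N ?f 1 0 \<noteq> 0"
    using anisotropic_leading[OF anisotropic_pull_SL2Zi[OF an N(1)]] .
  then have a0: "a' \<noteq> 0" by (simp add: fe hform_def)
  have T: "(1, g, 0, 1) \<in> Gamma1 g"
    using g gdvd_triv[of 1 g] by (auto simp: Gamma1_iff SL2Zi_def)
  have "4 * real_of_int D \<le> (cmod g)\<^sup>2 * (real_of_int a')\<^sup>2"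
    using separated_pull[OF sep f N(1)] a0 g De D0 unfolding fe
    by (intro separated_translation_bound[OF _ T refl]) auto
  then show False using N(2) g(2) by (simp add: fe hform_def)
qed

section \<open>Split primes\<close>

locale split_prime =
  fixes p :: nat and g :: complex
  assumes prime: "prime p" and gi: "gauss_int g" and norm: "g * cnj g = of_nat p"
    and not_ramified: "\<not> gdvd g (cnj g)"
begin

lemma g_nonzero: "g \<noteq> 0"
  using norm prime by auto

lemma cmod_g: "(cmod g)\<^sup>2 = p"
proof -
  have "complex_of_real ((cmod g)\<^sup>2) = complex_of_real p" unfolding complex_norm_square by (simp add: norm)
  then show ?thesis by (simp only: of_real_eq_iff)
qed

lemma prime_int: "Factorial_Ring.prime (int p)"
  using prime by simp

text \<open>Taking norms in \<open>n = g * q\<close> shows that \<open>p\<close> divides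
  \<open>n\<^sup>2\<close>. Together with \<open>residue_int\<close> this identifies the residue
  ring modulo \<open>g\<close> with the integers modulo \<open>p\<close>.\<close>

lemma gdvd_int_iff: "gdvd g (of_int n) \<longleftrightarrow> int p dvd n"
proof
  assume "int p dvd n"
  then obtain k where "n = int p * k" ..
  then have "of_int n = g * (cnj g * of_int k)" by (simp add: norm[symmetric])
  moreover have "gauss_int (cnj g * of_int k)" using gi by auto
  ultimately show "gdvd g (of_int n)" using gdvd_triv by metis
next
  assume "gdvd g (of_int n)"
  then obtain q where q: "gauss_int q" "of_int n = g * q" by (auto simp: gdvd_def)
  obtain k l :: int where kl: "q = Complex k l" using q(1) by (rule gauss_intE)
  have q2: "(cmod q)\<^sup>2 = real_of_int (k\<^sup>2 + l\<^sup>2)" by (simp add: kl cmod_power2)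
  have "(cmod (of_int n))\<^sup>2 = (cmod g)\<^sup>2 * (cmod q)\<^sup>2"
    by (simp only: q(2) norm_mult power_mult_distrib)
  then have "real_of_int (n\<^sup>2) = real_of_int (int p * (k\<^sup>2 + l\<^sup>2))"
    unfolding q2 cmod_g by simp
  then have "n\<^sup>2 = int p * (k\<^sup>2 + l\<^sup>2)" by (simp only: of_int_eq_iff)
  then have "int p dvd n\<^sup>2" by simp
  then show "int p dvd n" using prime_int prime_dvd_power by blast
qed

lemma gdvd_power_int: "int p ^ k dvd n \<Longrightarrow> gdvd (g ^ k) (of_int n)"
proof -
  assume "int p ^ k dvd n"
  then obtain m where "n = int p ^ k * m" ..
  then have "of_int n = g ^ k * (cnj g ^ k * of_int m)"
    by (simp add: norm[symmetric] power_mult_distrib)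
  moreover have "gauss_int (cnj g ^ k * of_int m)" using gi by auto
  ultimately show ?thesis using gdvd_triv by metis
qed

text \<open>Otherwise \<open>g\<close> would divide its trace and hence \<open>cnj g\<close>. As the
  trace is even, \<open>p\<close> is odd.\<close>

lemma trace_not_dvd:
  assumes t: "g + cnj g = of_int t"
  shows "\<not> int p dvd t"
proof
  assume "int p dvd t"
  then obtain k where "t = int p * k" ..
  then have "cnj g = g * (cnj g * of_int k - 1)"
    using t by (simp add: algebra_simps norm)
  then show False using not_ramified gi unfolding gdvd_def by (metis gauss_int_intros(2,3) gauss_int_intros1(2) gauss_int_simps(2,4))
qed

text \<open>Modulo \<open>g\<close> the power \<open>g ^ m\<close> vanishes and \<open>cnj g\<close>
  equals the trace \<open>s\<close>, so the trace of \<open>g ^ m\<close> is congruent to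
  \<open>s ^ m\<close>.\<close>

lemma trace_power_not_dvd:
  assumes m: "m \<ge> 1"
  obtains t where "g ^ m + cnj g ^ m = of_int t" "\<not> int p dvd t"
proof -
  have tr: "\<exists>t. z + cnj z = of_int t" if z: "gauss_int z" for z
  proof -
    obtain k l :: int where "z = Complex k l" using z by (rule gauss_intE)
    then have "z + cnj z = of_int (2 * k)" by (simp add: complex_eq_iff)
    then show ?thesis by blast
  qed
  obtain s where s: "g + cnj g = of_int s" using tr gi by blast
  obtain t where t: "g ^ m + cnj g ^ m = of_int t"
    using tr[of "g ^ m"] gi by (auto simp: gauss_int_intros1)
  have c: "gdvd g (cnj g ^ m - of_int s ^ m)"
  proof (induction m)
    case (Suc m)
    have e: "cnj g ^ Suc m - of_int s ^ Suc m = cnj g * (cnj g ^ m - of_int s ^ m) + g * (- (of_int s ^ m))"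
      unfolding s[symmetric] by (simp add: algebra_simps)
    show ?case unfolding e
      using Suc gi by (intro gdvd_add gdvd_mult_left gdvd_triv) auto
  qed simp
  have "\<not> int p dvd t"
  proof
    assume "int p dvd t"
    then have "gdvd g (g ^ m + cnj g ^ m)" using t gdvd_int_iff by simp
    moreover have "gdvd g (g ^ m)"
      using m gi gdvd_triv[of "g ^ (m - 1)" g] by (cases m) auto
    ultimately have "gdvd g (g ^ m + cnj g ^ m - g ^ m)" by (rule gdvd_diff)
    from gdvd_diff[OF this c]
    have "gdvd g (g ^ m + cnj g ^ m - g ^ m - (cnj g ^ m - of_int s ^ m))" .
    then have "gdvd g (of_int (s ^ m))" by simp
    then have "int p dvd s" using gdvd_int_iff prime_int prime_dvd_power by blast
    then show False using trace_not_dvd[OF s] by simp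
  qed
  then show thesis using that t by blast
qed

lemma inverse_mod:
  assumes "\<not> int p dvd n"
  obtains m :: nat where "int p ^ K dvd int m * n - 1"
proof -
  have "coprime n (int p ^ K)"
    using prime_imp_coprime[OF prime_int assms] by (simp add: coprime_commute)
  then obtain x y where xy: "x * n + y * int p ^ K = 1"
    using bezout_int[of n "int p ^ K"] by auto
  define m where "m = nat (x mod int p ^ K)"
  have pos: "int p ^ K > 0" using prime prime_gt_0_nat by simp
  have m: "int m = x - int p ^ K * (x div int p ^ K)"
    using pos by (simp add: m_def minus_mult_div_eq_mod)
  have "int m * n - 1 = int p ^ K * (- y - (x div int p ^ K) * n)"
    using xy by (simp add: m algebra_simps)
  then show thesis using that by (metis dvd_triv_left)
qed

text \<open>Write \<open>g = u + v * \<i>\<close>. Here \<open>v\<close> is prime to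
  \<open>p\<close>, and with \<open>m\<close> its inverse modulo \<open>p\<close>,
  \<open>\<i>\<close> is congruent to \<open>- u * m\<close>.\<close>

lemma residue_int:
  assumes "gauss_int z"
  obtains n where "gdvd g (z - of_int n)"
proof -
  obtain u v :: int where uv: "g = Complex u v" using gi by (rule gauss_intE)
  have gu: "g = of_int u + of_int v * \<i>" by (simp add: uv complex_eq_iff)
  have pv: "\<not> int p dvd v"
  proof
    assume "int p dvd v"
    then have "gdvd g (of_int v * \<i>)" using gdvd_int_iff gdvd_mult_right by simp
    then have "gdvd g (g * 1 - of_int v * \<i>)" using gdvd_triv[of 1 g] by (intro gdvd_diff) auto
    then have "gdvd g (of_int u)" using gu by simp
    then have "int p dvd 2 * u" using gdvd_int_iff by simp
    moreover have "g + cnj g = of_int (2 * u)" by (simp add: uv complex_eq_iff)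
    ultimately show False using trace_not_dvd by blast
  qed
  then obtain m where "int p ^ 1 dvd int m * v - 1" by (rule inverse_mod)
  then have "gdvd g (of_int (int m * v - 1))" unfolding gdvd_int_iff by simp
  then have "gdvd g (of_int (int m * v - 1) * \<i>)" by (rule gdvd_mult_right) simp
  moreover have "gdvd g (g * of_nat m)" by (intro gdvd_triv) auto
  ultimately have "gdvd g (g * of_nat m - of_int (int m * v - 1) * \<i>)" by auto
  also have "g * of_nat m - of_int (int m * v - 1) * \<i> = \<i> - of_int (- u * int m)"
    by (subst gu) (simp add: algebra_simps)
  finally have i: "gdvd g (\<i> - of_int (- u * int m))" .
  obtain k l :: int where kl: "z = Complex k l" using assms by (rule gauss_intE)
  have "z - of_int (k + l * (- u * int m)) = of_int l * (\<i> - of_int (- u * int m))"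
    by (simp add: kl complex_eq_iff)
  then show thesis using that gdvd_mult_left[OF i] gauss_int_simps(4) by metis
qed

end

section \<open>Stabilizer elements from solutions of Pell's equation\<close>

lemma hform_square:
  fixes a c :: real and B x y :: complex
  shows "a * hform a B c x y = (cmod (a * x + cnj B * y))\<^sup>2 - ((cmod B)\<^sup>2 - a * c) * (cmod y)\<^sup>2"
proof -
  have "complex_of_real (a * hform a B c x y) =
      complex_of_real ((cmod (a * x + cnj B * y))\<^sup>2 - ((cmod B)\<^sup>2 - a * c) * (cmod y)\<^sup>2)"
    unfolding of_real_diff of_real_mult complex_norm_square hform_complex
    by (simp add: algebra_simps)
  then show ?thesis by (simp only: of_real_eq_iff)
qed

text \<open>If \<open>D = s\<^sup>2\<close>, completing the square shows that
  \<open>(s - cnj B, a)\<close> is an isotropic vector.\<close>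

lemma anisotropic_disc_nonsquare:
  fixes a c D s :: int
  assumes an: "anisotropic (hform a B c)" and B: "gauss_int B"
    and D: "real_of_int D = (cmod B)\<^sup>2 - real_of_int (a * c)"
  shows "s\<^sup>2 \<noteq> D"
proof
  assume s: "s\<^sup>2 = D"
  have a0: "a \<noteq> 0"
    using anisotropic_leading[OF an] by (auto simp: hform_def)
  have e: "of_int a * (of_int s - cnj B) + cnj B * of_int a = (of_int (a * s) :: complex)"
    by (simp add: algebra_simps)
  have "a * hform a B c (of_int s - cnj B) (of_int a)
      = (cmod (of_int a * (of_int s - cnj B) + cnj B * of_int a))\<^sup>2 - of_int D * (cmod (of_int a))\<^sup>2"
    using hform_square[of a B c "of_int s - cnj B" "of_int a"] D by simp
  also have "\<dots> = 0"
    unfolding e s[symmetric] by (simp add: norm_mult power_mult_distrib)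
  finally have "a * hform a B c (of_int s - cnj B) (of_int a) = 0" .
  then have "hform a B c (of_int s - cnj B) (of_int a) = 0" using a0 by simp
  moreover have "gauss_int (of_int s - cnj B)" using B by auto
  ultimately have "(of_int a :: complex) = 0" using an unfolding anisotropic_def by (metis gauss_int_simps(4))
  then show False using a0 by simp
qed

text \<open>In the coordinates \<open>\<eta> = a * X + b * Y\<close> and \<open>Y\<close>,
  \<open>a\<close> times the form is
  \<open>\<bar>\<eta>\<bar>\<^sup>2 - D * \<bar>Y\<bar>\<^sup>2\<close>, and \<open>S\<close> is a
  Pell multiplication twisted by \<open>\<rho>\<close>. The factor \<open>a\<close> beside
  \<open>y\<close> keeps the entries integral on returning to \<open>X\<close>.\<close>

lemma pell_stabilizer:
  fixes a c D x y :: int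
  assumes D: "real_of_int D = (cmod B)\<^sup>2 - real_of_int (a * c)" and a: "a \<noteq> 0"
    and pell: "of_int x ^ 2 - of_int D * of_int a ^ 2 * of_int y ^ 2 * (\<rho> * cnj \<rho>) = 1"
  defines "b \<equiv> cnj B"
  defines "S \<equiv> (of_int x - of_int (a * y) * b * \<rho>, of_int y * (of_int D * cnj \<rho> - b\<^sup>2 * \<rho>),
     of_int (a\<^sup>2 * y) * \<rho>, of_int x + of_int (a * y) * b * \<rho>)"
  shows "mdet S = 1" "pull S (hform a B c) = hform a B c"
proof -
  show "mdet S = 1"
    using pell by (simp add: S_def mdet_def algebra_simps power2_eq_square)
  show "pull S (hform a B c) = hform a B c"
  proof (intro ext)
    fix X Y
    define \<eta> where "\<eta> = of_int a * X + b * Y"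
    obtain X' where X': "X' = (of_int x - of_int (a * y) * b * \<rho>) * X + (of_int y * (of_int D * cnj \<rho> - b\<^sup>2 * \<rho>)) * Y" by simp
    obtain Y' where Y': "Y' = of_int (a\<^sup>2 * y) * \<rho> * X + (of_int x + of_int (a * y) * b * \<rho>) * Y" by simp
    have \<eta>': "of_int a * X' + b * Y' = of_int x * \<eta> + of_int (a * D * y) * cnj \<rho> * Y"
      and Y'': "Y' = of_int (a * y) * \<rho> * \<eta> + of_int x * Y"
      by (simp_all add: X' Y' \<eta>_def algebra_simps power2_eq_square)
    have sq: "of_int a * hform a B c u v = (cmod (of_int a * u + b * v))\<^sup>2 - of_int D * (cmod v)\<^sup>2" for u v
      using hform_square[of a B c u v] D by (simp add: b_def)
    have "complex_of_real (of_int a * hform a B c X' Y') =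
      (of_int x ^ 2 - of_int D * of_int a ^ 2 * of_int y ^ 2 * (\<rho> * cnj \<rho>)) * (\<eta> * cnj \<eta> - of_int D * (Y * cnj Y))"
      unfolding sq unfolding \<eta>' unfolding Y'' of_real_diff of_real_mult complex_norm_square
      by (simp add: algebra_simps power2_eq_square)
    also have "\<dots> = complex_of_real (of_int a * hform a B c X Y)"
      unfolding pell sq of_real_diff of_real_mult complex_norm_square by (simp add: \<eta>_def)
    finally have "of_int a * hform a B c X' Y' = of_int a * hform a B c X Y"
      by (simp only: of_real_eq_iff)
    then show "pull S (hform a B c) X Y = hform a B c X Y"
      using a by (simp add: S_def pull_def X' Y')
  qed
qed

text \<open>Diagonal entries congruent to \<open>-1\<close> are excluded, so that translation
  lengths add under multiplication.\<close>

definition near_translation :: "complex \<Rightarrow> int \<Rightarrow> mat2 \<Rightarrow> bool" where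
  "near_translation h n M = (case M of (\<alpha>,\<beta>,\<gamma>,\<delta>) \<Rightarrow>
     gdvd h (\<alpha> - 1) \<and> gdvd h (\<beta> - of_int n) \<and> gdvd h \<gamma> \<and> gdvd h (\<delta> - 1))"

lemma near_translation_mmul:
  assumes "M \<in> SL2Zi" "near_translation h m M" "N \<in> SL2Zi" "near_translation h n N"
  shows "near_translation h (m + n) (mmul M N)"
proof -
  obtain \<alpha> \<beta> \<gamma> \<delta> where M4: "M = (\<alpha>,\<beta>,\<gamma>,\<delta>)" by (cases M)
  obtain a b c d where N4: "N = (a,b,c,d)" by (cases N)
  have gi: "gauss_int a" "gauss_int b" "gauss_int c" "gauss_int d" "gauss_int \<beta>" "gauss_int \<gamma>"
    "gauss_int \<delta>" using assms by (auto simp: M4 N4 SL2Zi_def)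
  have dv: "gdvd h (\<alpha> - 1)" "gdvd h (\<beta> - of_int m)" "gdvd h \<gamma>" "gdvd h (\<delta> - 1)"
    "gdvd h (a - 1)" "gdvd h (b - of_int n)" "gdvd h c" "gdvd h (d - 1)"
    using assms by (auto simp: M4 N4 near_translation_def)
  have F: "gdvd h ((\<alpha> - 1) * a + (a - 1) + \<beta> * c)"
    "gdvd h ((\<alpha> - 1) * b + (b - of_int n) + \<beta> * (d - 1) + (\<beta> - of_int m))"
    "gdvd h (\<gamma> * a + \<delta> * c)"
    "gdvd h (\<gamma> * b + (\<delta> - 1) * d + (d - 1))"
    by (intro gdvd_add gdvd_mult_right[OF dv(1)] gdvd_mult_left[OF dv(7)] gdvd_mult_left[OF dv(8)]
        gdvd_mult_right[OF dv(3)] gdvd_mult_right[OF dv(4)] dv gi)+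
  have e: "(\<alpha> - 1) * a + (a - 1) + \<beta> * c = \<alpha> * a + \<beta> * c - 1"
    "(\<alpha> - 1) * b + (b - of_int n) + \<beta> * (d - 1) + (\<beta> - of_int m) = \<alpha> * b + \<beta> * d - of_int (m + n)"
    "\<gamma> * b + (\<delta> - 1) * d + (d - 1) = \<gamma> * b + \<delta> * d - 1"
    by (simp_all add: algebra_simps)
  show ?thesis unfolding M4 N4 mmul_def near_translation_def prod.case
    using F[unfolded e] by blast
qed

context split_prime
begin

text \<open>The entry \<open>y * D * cnj \<rho>\<close> is congruent to \<open>y * D * (\<rho> + cnj \<rho>)\<close> modulo \<open>g ^ K\<close>; this is
  an integer, and prime to \<open>p\<close> because \<open>p\<close> splits.\<close>
lemma stabilizer_near_translation:
  fixes a c D :: int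
  assumes D: "real_of_int D = (cmod B)\<^sup>2 - real_of_int (a * c)" and D0: "D > 0"
    and B: "gauss_int B" and an: "anisotropic (hform a B c)" and pD: "\<not> int p dvd D"
    and K: "K \<ge> 1"
  obtains S n where "S \<in> SL2Zi" "pull S (hform a B c) = hform a B c" "\<not> int p dvd n"
    "near_translation (g ^ K) n S"
proof -
  have a0: "a \<noteq> 0"
    using anisotropic_leading[OF an] by (auto simp: hform_def)
  have pos: "D * a\<^sup>2 > 0" using D0 a0 by simp
  have nsq: "s\<^sup>2 \<noteq> D * a\<^sup>2" for s
  proof
    assume s: "s\<^sup>2 = D * a\<^sup>2"
    then have "a\<^sup>2 dvd s\<^sup>2" by simp
    then have "a dvd s" by simp
    then obtain t where "s = a * t" ..
    with s a0 have "t\<^sup>2 = D" by (simp add: power_mult_distrib)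
    then show False using anisotropic_disc_nonsquare[OF an B D] by blast
  qed
  obtain x0 y w where pell0: "x0\<^sup>2 - D * a\<^sup>2 * int p ^ (2 * w) * y\<^sup>2 = 1" and y: "\<not> int p dvd y" and w: "w \<ge> K"
    using pell_solution_coprime[OF pos nsq prime] .
  \<comment> \<open>\<open>p ^ K\<close> divides \<open>(x0 - 1) * (x0 + 1)\<close>. As
    \<open>p\<close> is odd, it divides at most one factor, and a change of sign of
    \<open>x0\<close> makes that factor \<open>x - 1\<close>.\<close>
  obtain x where pell: "x\<^sup>2 - D * a\<^sup>2 * int p ^ (2 * w) * y\<^sup>2 = 1" and x: "int p ^ K dvd x - 1"
  proof -
    have "int p ^ K dvd int p ^ (2 * w)" using w by (intro le_imp_power_dvd) simp
    then have "int p ^ K dvd (x0 - 1) * (x0 + 1)"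
    proof -
      have "(x0 - 1) * (x0 + 1) = int p ^ (2 * w) * (D * a\<^sup>2 * y\<^sup>2)"
        using pell0 by (simp add: algebra_simps power2_eq_square)
      then show ?thesis using dvd_mult2 \<open>int p ^ K dvd int p ^ (2 * w)\<close> by metis
    qed
    moreover have "\<not> (int p dvd x0 - 1 \<and> int p dvd x0 + 1)"
    proof
      assume "int p dvd x0 - 1 \<and> int p dvd x0 + 1"
      then have "int p dvd (x0 + 1) - (x0 - 1)" using dvd_diff by blast
      then have p2: "int p dvd 2" by simp
      obtain u v :: int where "g = Complex u v" using gi by (rule gauss_intE)
      then have "g + cnj g = of_int (2 * u)" by (simp add: complex_eq_iff)
      then have "\<not> int p dvd 2 * u" by (rule trace_not_dvd)
      then show False using p2 by simp
    qed
    ultimately consider "int p ^ K dvd x0 - 1" | "int p ^ K dvd x0 + 1"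
    proof -
      assume d: "int p ^ K dvd (x0 - 1) * (x0 + 1)" and "\<not> (int p dvd x0 - 1 \<and> int p dvd x0 + 1)"
        and *: "int p ^ K dvd x0 - 1 \<Longrightarrow> thesis" "int p ^ K dvd x0 + 1 \<Longrightarrow> thesis"
      then consider "coprime (int p) (x0 - 1)" | "coprime (int p) (x0 + 1)"
        using prime_imp_coprime[OF prime_int] by blast
      then show thesis
      proof cases
        case 1
        then have "coprime (int p ^ K) (x0 - 1)" by simp
        then show thesis using d *(2) by (simp add: coprime_dvd_mult_right_iff)
      next
        case 2
        then have "coprime (int p ^ K) (x0 + 1)" by simp
        then show thesis using d *(1) by (simp add: coprime_dvd_mult_left_iff)
      qed
    qed
    then show thesis
    proof cases
      case 1
      show thesis by (rule that[OF pell0 1])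
    next
      case 2
      have "(- x0) - 1 = - (x0 + 1)" by simp
      then have "int p ^ K dvd (- x0) - 1" using 2 by (simp only: dvd_minus_iff)
      with pell0 show thesis by (intro that[of "- x0"]) auto
    qed
  qed
  \<comment> \<open>Its norm is the factor \<open>p ^ (2 * w)\<close> of the Pell equation, and
    \<open>w \<ge> K\<close> makes it vanish modulo \<open>g ^ K\<close>.\<close>
  define \<rho> where "\<rho> = g ^ (2 * w)"
  have \<rho>: "gauss_int \<rho>" using gi by (auto simp: \<rho>_def)
  have "\<rho> * cnj \<rho> = of_int (int p ^ (2 * w))"
    by (simp add: \<rho>_def norm flip: power_mult_distrib)
  then have pellc: "of_int x ^ 2 - of_int D * of_int a ^ 2 * of_int y ^ 2 * (\<rho> * cnj \<rho>) = 1"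
    using arg_cong[OF pell, of "of_int :: int \<Rightarrow> complex"] by (simp add: mult_ac)
  define b where "b = cnj B"
  define S where "S = (of_int x - of_int (a * y) * b * \<rho>, of_int y * (of_int D * cnj \<rho> - b\<^sup>2 * \<rho>),
     of_int (a\<^sup>2 * y) * \<rho>, of_int x + of_int (a * y) * b * \<rho>)"
  have det: "mdet S = 1" and pS: "pull S (hform a B c) = hform a B c"
    using pell_stabilizer[OF D a0 pellc] by (simp_all only: S_def b_def)
  have b: "gauss_int b" using B by (auto simp: b_def)
  have S: "S \<in> SL2Zi"
  proof -
    have "gauss_int (of_int x - of_int (a * y) * b * \<rho>)" "gauss_int (of_int (a\<^sup>2 * y) * \<rho>)"
      "gauss_int (of_int y * (of_int D * cnj \<rho> - b\<^sup>2 * \<rho>))" "gauss_int (of_int x + of_int (a * y) * b * \<rho>)"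
      using \<rho> b by (auto simp del: of_int_mult of_int_power)
    then show ?thesis
      using det unfolding S_def SL2Zi_def mdet_def by (simp only: mem_Collect_eq prod.case simp_thms)
  qed
  have "2 * w \<ge> 1" using w K by simp
  then obtain t where t1: "g ^ (2 * w) + cnj g ^ (2 * w) = of_int t" and t2: "\<not> int p dvd t"
    by (rule trace_power_not_dvd)
  have t': "cnj \<rho> = of_int t - \<rho>" using t1 by (simp add: \<rho>_def algebra_simps)
  define n where "n = y * D * t"
  have n: "\<not> int p dvd n"
    using y pD t2 prime_int by (simp add: n_def prime_dvd_mult_iff)
  have g\<rho>: "gdvd (g ^ K) \<rho>"
  proof -
    have "\<rho> = g ^ K * g ^ (2 * w - K)" using w by (simp add: \<rho>_def flip: power_add)
    then show ?thesis using gdvd_triv gi by (metis gauss_int_intros1(3))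
  qed
  have gx: "gdvd (g ^ K) (of_int x - 1)" using gdvd_power_int[OF x] by simp
  have "near_translation (g ^ K) n S"
  proof -
    have e: "of_int x - of_int (a * y) * b * \<rho> - 1 = (of_int x - 1) - of_int (a * y) * b * \<rho>"
      "of_int y * (of_int D * cnj \<rho> - b\<^sup>2 * \<rho>) - of_int n = (- (of_int y * (of_int D + b\<^sup>2))) * \<rho>"
      "of_int x + of_int (a * y) * b * \<rho> - 1 = (of_int x - 1) + of_int (a * y) * b * \<rho>"
      by (simp_all add: t' n_def algebra_simps)
    have "gauss_int (of_int (a * y) * b)" "gauss_int (- (of_int y * (of_int D + b\<^sup>2)))" "gauss_int (of_int (a\<^sup>2 * y))"
      using b by (auto simp del: of_int_mult of_int_power)
    then show ?thesis
      unfolding S_def near_translation_def prod.case e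
      using gdvd_diff[OF gx gdvd_mult_left[OF g\<rho>]] gdvd_add[OF gx gdvd_mult_left[OF g\<rho>]]
        gdvd_mult_left[OF g\<rho>] by blast
  qed
  then show thesis using that S pS n by blast
qed

text \<open>The \<open>k\<close>-th power of an element near the translation by \<open>n\<close> is
  near the translation by \<open>k * n\<close>; take \<open>k\<close> inverse to \<open>n\<close>
  modulo \<open>p ^ K\<close>.\<close>

lemma stabilizer_unit_translation:
  fixes a c D :: int
  assumes D: "real_of_int D = (cmod B)\<^sup>2 - real_of_int (a * c)" and D0: "D > 0"
    and B: "gauss_int B" and an: "anisotropic (hform a B c)" and pD: "\<not> int p dvd D"
    and K: "K \<ge> 1"
  obtains S where "S \<in> SL2Zi" "pull S (hform a B c) = hform a B c" "near_translation (g ^ K) 1 S"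
proof -
  obtain S n where S: "S \<in> SL2Zi" "pull S (hform a B c) = hform a B c" and n: "\<not> int p dvd n"
    and SN: "near_translation (g ^ K) n S"
    using stabilizer_near_translation[OF assms] .
  have pw: "\<exists>T\<in>SL2Zi. pull T (hform a B c) = hform a B c \<and> near_translation (g ^ K) (int k * n) T" for k
  proof (induction k)
    case 0
    have "(1,0,0,1) \<in> SL2Zi" by (simp add: SL2Zi_def)
    then show ?case by (intro bexI[of _ "(1,0,0,1)"]) (simp_all add: near_translation_def pull_def)
  next
    case (Suc k)
    then obtain T where T: "T \<in> SL2Zi" "pull T (hform a B c) = hform a B c" "near_translation (g ^ K) (int k * n) T" by blast
    have "near_translation (g ^ K) (int (Suc k) * n) (mmul T S)"
      using near_translation_mmul[OF T(1,3) S(1) SN] by (simp add: algebra_simps)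
    then show ?case using SL2Zi_mmul[OF T(1) S(1)] T(2) S(2) by (intro bexI[of _ "mmul T S"]) (simp_all add: pull_mmul)
  qed
  obtain k where k: "int p ^ K dvd int k * n - 1" using inverse_mod[OF n] .
  obtain T where T: "T \<in> SL2Zi" "pull T (hform a B c) = hform a B c" "near_translation (g ^ K) (int k * n) T"
    using pw by blast
  have "gdvd (g ^ K) (of_int (int k * n - 1))" using gdvd_power_int[OF k] .
  then have "gdvd (g ^ K) (\<beta> - 1)" if "gdvd (g ^ K) (\<beta> - of_int (int k * n))" for \<beta>
    using gdvd_add[OF that, of "of_int (int k * n - 1)"] by simp
  then have "near_translation (g ^ K) 1 T"
    using T(3) unfolding near_translation_def by (cases T) simp
  then show thesis using that T by blast
qed

text \<open>Following the translation by \<open>-1\<close> with \<open>S\<close> gives an element of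
  the congruence subgroup that pulls the form back as the translation alone does. The radius is
  therefore at most 1/2.\<close>

lemma separated_bound:
  fixes a c D :: int
  assumes D: "real_of_int D = (cmod B)\<^sup>2 - real_of_int (a * c)" and D0: "D > 0"
    and B: "gauss_int B" and an: "anisotropic (hform a B c)" and pD: "\<not> int p dvd D"
    and K: "K \<ge> 1" and sep: "separated (Gamma1 (g ^ K)) (hform a B c)"
  shows "4 * D \<le> a\<^sup>2"
proof -
  obtain S where S: "S \<in> SL2Zi" "pull S (hform a B c) = hform a B c" "near_translation (g ^ K) 1 S"
    using stabilizer_unit_translation[OF D D0 B an pD K] .
  obtain \<alpha> \<beta> \<gamma> \<delta> where S4: "S = (\<alpha>,\<beta>,\<gamma>,\<delta>)" by (cases S)
  have T: "(1,-1,0,1) \<in> SL2Zi" by (auto simp: SL2Zi_def)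
  have N: "mmul S (1,-1,0,1) = (\<alpha>, \<beta> - \<alpha>, \<gamma>, \<delta> - \<gamma>)" by (simp add: S4 mmul_def)
  have dv: "gdvd (g ^ K) (\<alpha> - 1)" "gdvd (g ^ K) (\<beta> - 1)" "gdvd (g ^ K) \<gamma>" "gdvd (g ^ K) (\<delta> - 1)"
    using S(3) by (auto simp: near_translation_def S4)
  have "gdvd (g ^ K) (\<beta> - \<alpha>)" "gdvd (g ^ K) (\<delta> - \<gamma> - 1)"
    using gdvd_diff[OF dv(2,1)] gdvd_diff[OF dv(4,3)] by (simp_all add: algebra_simps)
  then have NG: "mmul S (1,-1,0,1) \<in> Gamma1 (g ^ K)"
    using SL2Zi_mmul[OF S(1) T] dv unfolding N Gamma1_iff by auto
  have pN: "pull (mmul S (1,-1,0,1)) (hform a B c) = pull (1,-1,0,1) (hform a B c)"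
    by (simp add: pull_mmul S(2))
  have a0: "real_of_int a \<noteq> 0" using anisotropic_leading[OF an] by (auto simp: hform_def)
  have "4 * real_of_int D \<le> (cmod (-1))\<^sup>2 * (real_of_int a)\<^sup>2"
    using D D0 by (intro separated_translation_bound[OF sep NG pN a0]) auto
  then have "real_of_int (4 * D) \<le> real_of_int (a\<^sup>2)" by simp
  then show ?thesis by (simp only: of_int_le_iff)
qed

text \<open>Normality lets one pass to a representative with \<open>a\<^sup>2 < 2 * D\<close>, which
  contradicts \<open>4 * D \<le> a\<^sup>2\<close>.\<close>

lemma separated_imp_prime_dvd_disc:
  assumes f: "int_form f D" and an: "anisotropic f" and D0: "D > 0"
    and K: "K \<ge> 1" and sep: "separated (Gamma1 (g ^ K)) f"
  shows "int p dvd D"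
proof (rule ccontr)
  assume pD: "\<not> int p dvd D"
  obtain N where N: "N \<in> SL2Zi" "(pull N f 1 0)\<^sup>2 < 2 * D"
    using large_radius_representative[OF f an D0] .
  obtain a c :: int and B where B: "gauss_int B" and fe: "pull N f = hform a B c"
    and De: "real_of_int D = (cmod B)\<^sup>2 - real_of_int (a * c)"
    using int_form_pull[OF f N(1)] by (auto simp: int_form_def)
  have "4 * D \<le> a\<^sup>2"
    using separated_bound[OF De D0 B _ pD K] anisotropic_pull_SL2Zi[OF an N(1)] separated_pull[OF sep f N(1)]
    by (simp add: fe)
  then have "real_of_int (4 * D) \<le> real_of_int (a\<^sup>2)" by (simp only: of_int_le_iff)
  then show False using N(2) D0 by (simp add: fe hform_def)
qed

end

section \<open>Descent on the discriminant\<close>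

context split_prime
begin

text \<open>The common end of both descent cases. Conjugation by a matrix of determinant
  \<open>g\<close> has denominator \<open>g\<close>, which costs one power in the level.\<close>

lemma descent_reduction:
  assumes an: "anisotropic (hform a B c)"
    and sep: "separated (Gamma1 (g ^ K)) (hform a B c)"
    and M: "M = (\<alpha>,\<beta>,\<gamma>,\<delta>)" "gauss_int \<alpha>" "gauss_int \<beta>" "gauss_int \<gamma>" "gauss_int \<delta>" "mdet M = g"
    and f: "\<And>x y. pull M (hform a B c) x y = real p * f x y"
    and G: "\<And>N. N \<in> Gamma1 (g ^ Suc K) \<Longrightarrow> \<exists>N'\<in>Gamma1 (g ^ K). mmul N' M = mmul M N"
  shows "anisotropic f" "separated (Gamma1 (g ^ Suc K)) f"
proof -
  have p0: "real p \<noteq> 0" using prime by auto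
  show "separated (Gamma1 (g ^ Suc K)) f"
    by (rule separated_conj[OF sep _ p0 f G]) (use M g_nonzero in auto)
  have "anisotropic (pull M (hform a B c))"
    using M g_nonzero unfolding M(1) by (intro anisotropic_pull[OF an]) auto
  then show "anisotropic f" unfolding anisotropic_def f by auto
qed

text \<open>In the conjugate only \<open>c\<close> gets divided by \<open>g\<close>; the term
  \<open>j * (d - a)\<close> is harmless because both diagonal entries have the same residue
  \<open>\<epsilon>\<close>.\<close>

lemma Gamma1_conj_upper:
  fixes j :: int
  assumes N: "N \<in> Gamma1 (g ^ Suc K)"
  shows "\<exists>N'\<in>Gamma1 (g ^ K). mmul N' (g, of_int j, 0, 1) = mmul (g, of_int j, 0, 1) N"
proof -
  obtain a b c d where N4: "N = (a,b,c,d)" by (cases N)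
  obtain \<epsilon> where S: "gauss_int a" "gauss_int b" "gauss_int c" "gauss_int d" and det: "a*d - b*c = 1"
    and \<epsilon>: "\<epsilon> \<in> {1,-1}" and dv: "gdvd (g ^ Suc K) c" "gdvd (g ^ Suc K) (a - \<epsilon>)" "gdvd (g ^ Suc K) (d - \<epsilon>)"
      "gdvd (g ^ Suc K) b"
    using N unfolding N4 Gamma1_iff SL2Zi_def by blast
  have gK: "gdvd (g ^ K) x" if "gdvd (g ^ Suc K) x" for x
    using gdvd_trans[OF _ that] gdvd_triv[OF gi, of "g ^ K"] by (simp add: mult.commute)
  obtain c1 where c1: "gauss_int c1" "c = g ^ Suc K * c1" using dv(1) by (auto simp: gdvd_def)
  define G where "G = g ^ K * c1"
  have G: "gauss_int G" "gdvd (g ^ K) G" using c1 gi by (auto simp: G_def gdvd_triv)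
  have c: "c = g * G" by (simp add: c1 G_def)
  let ?j = "of_int j :: complex"
  define N' where "N' = (a + ?j * G, ?j * (d - a) - ?j\<^sup>2 * G + g * b, G, d - ?j * G)"
  have "(a + ?j * G) * (d - ?j * G) - (?j * (d - a) - ?j\<^sup>2 * G + g * b) * G = a*d - b*c"
    by (simp add: c algebra_simps power2_eq_square)
  then have "N' \<in> SL2Zi"
    unfolding N'_def SL2Zi_def using det S G gi by (auto simp: power2_eq_square)
  moreover have "gdvd (g ^ K) (a + ?j * G - \<epsilon>)"
    using gdvd_add[OF gK[OF dv(2)] gdvd_mult_left[OF G(2), of ?j]] by (simp add: algebra_simps)
  moreover have "gdvd (g ^ K) (d - ?j * G - \<epsilon>)"
    using gdvd_diff[OF gK[OF dv(3)] gdvd_mult_left[OF G(2), of ?j]] by (simp add: algebra_simps)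
  moreover have "gdvd (g ^ K) (?j * (d - a) - ?j\<^sup>2 * G + g * b)"
  proof -
    have "gdvd (g ^ K) ((d - \<epsilon>) - (a - \<epsilon>))" by (rule gdvd_diff[OF gK[OF dv(3)] gK[OF dv(2)]])
    then have "gdvd (g ^ K) (d - a)" by simp
    then show ?thesis
      by (intro gdvd_add[OF gdvd_diff] gdvd_mult_left gK[OF dv(4)] G(2) gi) auto
  qed
  ultimately have "N' \<in> Gamma1 (g ^ K)"
    using \<epsilon> G unfolding N'_def Gamma1_iff by blast
  moreover have "mmul N' (g, ?j, 0, 1) = mmul (g, ?j, 0, 1) N"
    by (simp add: N'_def N4 mmul_def c algebra_simps power2_eq_square)
  ultimately show ?thesis by blast
qed

text \<open>Here conjugation divides \<open>b\<close> by \<open>g\<close> and multiplies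
  \<open>c\<close> by \<open>g\<close>.\<close>

lemma Gamma1_conj_diag:
  assumes N: "N \<in> Gamma1 (g ^ Suc K)"
  shows "\<exists>N'\<in>Gamma1 (g ^ K). mmul N' (1, 0, 0, g) = mmul (1, 0, 0, g) N"
proof -
  obtain a b c d where N4: "N = (a,b,c,d)" by (cases N)
  obtain \<epsilon> where S: "gauss_int a" "gauss_int b" "gauss_int c" "gauss_int d" and det: "a*d - b*c = 1"
    and \<epsilon>: "\<epsilon> \<in> {1,-1}" and dv: "gdvd (g ^ Suc K) c" "gdvd (g ^ Suc K) (a - \<epsilon>)" "gdvd (g ^ Suc K) (d - \<epsilon>)"
      "gdvd (g ^ Suc K) b"
    using N unfolding N4 Gamma1_iff SL2Zi_def by blast
  have gK: "gdvd (g ^ K) x" if "gdvd (g ^ Suc K) x" for x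
    using gdvd_trans[OF _ that] gdvd_triv[OF gi, of "g ^ K"] by (simp add: mult.commute)
  obtain b1 where b1: "gauss_int b1" "b = g ^ Suc K * b1" using dv(4) by (auto simp: gdvd_def)
  define G where "G = g ^ K * b1"
  have G: "gauss_int G" "gdvd (g ^ K) G" using b1 gi by (auto simp: G_def gdvd_triv)
  have b: "b = g * G" by (simp add: b1 G_def)
  have "(a, G, c * g, d) \<in> SL2Zi"
    unfolding SL2Zi_def using det S G gi by (auto simp: b algebra_simps)
  then have "(a, G, c * g, d) \<in> Gamma1 (g ^ K)"
    using \<epsilon> G gK[OF dv(2)] gK[OF dv(3)] gdvd_mult_right[OF gK[OF dv(1)] gi] unfolding Gamma1_iff by blast
  moreover have "mmul (a, G, c * g, d) (1, 0, 0, g) = mmul (1, 0, 0, g) N"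
    by (simp add: N4 mmul_def b)
  ultimately show ?thesis by blast
qed

text \<open>If \<open>p\<close> divides \<open>D\<close> then the Hermitian matrix of the form is singular modulo the prime ideal
  \<open>\<langle>g\<rangle>\<close>. A matrix of determinant \<open>g\<close> whose image modulo \<open>g\<close> is the kernel makes all coefficients
  divisible by \<open>p\<close>.\<close>
lemma descent:
  assumes f: "int_form f D" and an: "anisotropic f"
    and sep: "separated (Gamma1 (g ^ K)) f" and pD: "int p dvd D"
  obtains f' where "int_form f' (D div int p)" "anisotropic f'" "separated (Gamma1 (g ^ Suc K)) f'"
proof -
  obtain a c :: int and B where B: "gauss_int B" and fe: "f = hform a B c"
    and D: "real_of_int D = (cmod B)\<^sup>2 - real_of_int (a * c)"
    using f by (auto simp: int_form_def)
  note descended = that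
  note an' = an[unfolded fe] and sep' = sep[unfolded fe]
  have p0: "real p \<noteq> 0" using prime by auto
  define D' where "D' = D div int p"
  have D': "D = int p * D'" using pD by (simp add: D'_def)
  \<comment> \<open>Modulo \<open>g\<close> both \<open>B\<close> and \<open>cnj B\<close> become
    integers, in general different ones, so the singularity of the Hermitian matrix is a congruence
    modulo \<open>p\<close>.\<close>
  obtain b1 where b1: "gdvd g (cnj B - of_int b1)" using residue_int B by blast
  obtain b2 where b2: "gdvd g (B - of_int b2)" using residue_int B by blast
  have Dc: "of_int D = B * cnj B - of_int (a * c)"
  proof -
    have "complex_of_real (real_of_int D) = complex_of_real ((cmod B)\<^sup>2) - complex_of_real (real_of_int (a * c))"
      unfolding D by simp
    then show ?thesis unfolding complex_norm_square by simp
  qed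
  have sing: "int p dvd b1 * b2 - a * c"
  proof -
    have "gdvd g (of_int D)" using pD gdvd_int_iff by blast
    moreover have "gdvd g ((cnj B - of_int b1) * B)" using gdvd_mult_right[OF b1 B] .
    moreover have "gdvd g ((B - of_int b2) * of_int b1)" using gdvd_mult_right[OF b2] by simp
    ultimately have "gdvd g (of_int D - (cnj B - of_int b1) * B - (B - of_int b2) * of_int b1)"
      by (metis gdvd_diff)
    also have "of_int D - (cnj B - of_int b1) * B - (B - of_int b2) * of_int b1 = of_int (b1 * b2 - a * c)"
      unfolding Dc by (simp add: algebra_simps)
    finally show ?thesis unfolding gdvd_int_iff .
  qed
  \<comment> \<open>By the first condition \<open>g\<close> divides \<open>a * j + cnj B\<close>, so
    \<open>cnj g\<close> divides \<open>a * j + B\<close> and \<open>p\<close> divides the new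
    middle coefficient \<open>g * (a * j + B)\<close>. The second makes the value at
    \<open>(j, 1)\<close> divisible by \<open>p\<close>; the leading coefficient is
    \<open>p * a\<close>.\<close>
  have upper: thesis if j1: "int p dvd a * j + b1" and j2: "int p dvd a * j\<^sup>2 + (b1 + b2) * j + c" for j
  proof -
    have "gdvd g (of_int (a * j + b1))" using j1 gdvd_int_iff by blast
    from gdvd_add[OF this b1] have "gdvd g (of_int (a * j) + cnj B)" by simp
    then obtain q where q: "gauss_int q" "of_int (a * j) + cnj B = g * q" by (auto simp: gdvd_def)
    have q': "of_int (a * j) + B = cnj g * cnj q" using arg_cong[OF q(2), of cnj] by simp
    obtain e :: int where e: "hform a B c (of_int j) 1 = e"
      using hform_Ints[OF B, of "of_int j" 1 a c] by (auto elim: Ints_cases)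
    have ec: "of_int e = of_int (a * j\<^sup>2) + (B + cnj B) * of_int j + of_int c"
    proof -
      have "complex_of_real (of_int e) = of_int (a * j\<^sup>2) + (B + cnj B) * of_int j + of_int c"
        unfolding e[symmetric] hform_complex by (simp add: algebra_simps power2_eq_square)
      then show ?thesis by simp
    qed
    have "int p dvd e"
    proof -
      have 1: "gdvd g (of_int (a * j\<^sup>2 + (b1 + b2) * j + c))" using j2 gdvd_int_iff by blast
      have 2: "gdvd g (((B - of_int b2) + (cnj B - of_int b1)) * of_int j)"
        using gdvd_mult_right[OF gdvd_add[OF b2 b1]] by simp
      have "gdvd g (of_int e)"
        using gdvd_add[OF 1 2] unfolding ec by (simp add: algebra_simps)
      then show ?thesis unfolding gdvd_int_iff .
    qed
    then obtain c' where c': "e = int p * c'" ..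
    define f' where "f' = hform a (cnj q) c'"
    have pull: "pull (g, of_int j, 0, 1) (hform a B c) x y = real p * f' x y" for x y
    proof -
      have "a * g * cnj (of_int j) + B * g * cnj 1 + cnj B * cnj (of_int j) * 0 + c * 0 * cnj 1
        = g * (of_int (a * j) + B)" by (simp add: algebra_simps)
      also have "\<dots> = of_nat p * cnj q" unfolding q' by (simp add: norm flip: mult.assoc)
      finally have "pull (g, of_int j, 0, 1) (hform a B c) = hform (hform a B c g 0) (of_nat p * cnj q) e"
        unfolding pull_hform e by simp
      also have "hform a B c g 0 = p * a" by (simp add: hform_def cmod_g)
      finally have eq: "pull (g, of_int j, 0, 1) (hform a B c) = hform (p * a) (of_nat p * cnj q) e" .
      show ?thesis unfolding eq by (simp add: f'_def hform_def c' algebra_simps)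
    qed
    have "int_form f' D'"
    proof -
      have "real p * (cmod (cnj q))\<^sup>2 = (cmod (of_int (a * j) + cnj B))\<^sup>2"
        unfolding q(2) by (simp add: norm_mult power_mult_distrib cmod_g)
      also have "\<dots> = a * real_of_int e + real_of_int D"
        using hform_square[of a B c "of_int j" 1] D by (simp add: e)
      finally have "real p * ((cmod (cnj q))\<^sup>2 - real_of_int (a * c')) = real p * real_of_int D'"
        by (simp add: c' D' algebra_simps)
      then show ?thesis using q(1) p0 unfolding int_form_def f'_def
        by (intro exI[of _ a] exI[of _ "cnj q"] exI[of _ c']) auto
    qed
    moreover have "mdet (g, of_int j, 0, 1) = g" by (simp add: mdet_def)
    then have "anisotropic f'" "separated (Gamma1 (g ^ Suc K)) f'"
      using descent_reduction[OF an' sep' refl _ _ _ _ _ pull Gamma1_conj_upper] gi by auto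
    ultimately show thesis using descended D'_def by blast
  qed
  show thesis
  proof (cases "int p dvd a")
    case False
    then obtain m where "int p ^ 1 dvd int m * a - 1" by (rule inverse_mod)
    then have m: "int p dvd int m * a - 1" by simp
    \<comment> \<open>The root of \<open>a * j + b1\<close> modulo \<open>p\<close>. Multiplied by
      \<open>a\<close>, the second condition follows from this and \<open>sing\<close>.\<close>
    define j where "j = - (int m * b1)"
    have "a * j + b1 = (int m * a - 1) * (- b1)" by (simp add: j_def algebra_simps)
    then have j1: "int p dvd a * j + b1" using m by simp
    have "a * (a * j\<^sup>2 + (b1 + b2) * j + c) = (a * j + b1) * (a * j + b2) - (b1 * b2 - a * c)"
      by (simp add: algebra_simps power2_eq_square)
    then have "int p dvd a * (a * j\<^sup>2 + (b1 + b2) * j + c)" using j1 sing by simp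
    then have "int p dvd a * j\<^sup>2 + (b1 + b2) * j + c"
      using False prime_int by (simp add: prime_dvd_mult_iff)
    with j1 show thesis by (rule upper)
  next
    case True
    show thesis
    proof (cases "int p dvd b2")
      case False
      have "int p dvd b1 * b2" using sing True by (metis dvd_diffD1 dvd_mult2 dvd_diff_commute dvd_diff_right_iff)
      then have pb1: "int p dvd b1" using False prime_int by (simp add: prime_dvd_mult_iff)
      obtain m where "int p ^ 1 dvd int m * b2 - 1" using inverse_mod[OF False] .
      then have m: "int p dvd int m * b2 - 1" by simp
      \<comment> \<open>Since \<open>p\<close> divides \<open>a\<close> and \<open>b1\<close>, only
        \<open>b2 * j + c\<close> is left of the second condition.\<close>
      define j where "j = - (int m * c)"
      have "b2 * j + c = (int m * b2 - 1) * (- c)" by (simp add: j_def algebra_simps)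
      then have j: "int p dvd b2 * j + c" using m by simp
      have "int p dvd a * j\<^sup>2 + b1 * j + (b2 * j + c)"
        using True pb1 j by (metis dvd_add dvd_mult2)
      also have "a * j\<^sup>2 + b1 * j + (b2 * j + c) = a * j\<^sup>2 + (b1 + b2) * j + c" by (simp add: algebra_simps)
      finally have "int p dvd a * j\<^sup>2 + (b1 + b2) * j + c" .
      moreover have "int p dvd a * j + b1" using True pb1 by simp
      ultimately show thesis by (rule upper[rotated])
    next
      case b2p: True
      obtain a' where a': "a = int p * a'" using True ..
      \<comment> \<open>Now \<open>g\<close> divides \<open>B\<close>, and the diagonal matrix turns
        the coefficients into \<open>a\<close>, \<open>B * cnj g\<close> and \<open>p * c\<close>,
        all divisible by \<open>p\<close>.\<close>
      have "gdvd g (of_int b2 + (B - of_int b2))" using b2p b2 gdvd_int_iff by (intro gdvd_add) auto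
      then obtain q where q: "gauss_int q" "B = g * q" by (auto simp: gdvd_def)
      define f' where "f' = hform a' q c"
      have pull: "pull (1, 0, 0, g) (hform a B c) x y = real p * f' x y" for x y
      proof -
        have "B * cnj g = of_nat p * q" unfolding q(2) norm[symmetric] by simp
        then have "pull (1, 0, 0, g) (hform a B c) = hform (p * a') (of_nat p * q) (hform a B c 0 g)"
          unfolding pull_hform by (simp add: a' hform_def)
        also have "hform a B c 0 g = p * c" by (simp add: hform_def cmod_g)
        finally have eq: "pull (1, 0, 0, g) (hform a B c) = hform (p * a') (of_nat p * q) (p * c)" .
        show ?thesis unfolding eq by (simp add: f'_def hform_def algebra_simps)
      qed
      have "int_form f' D'"
      proof -
        have "real p * ((cmod q)\<^sup>2 - real_of_int (a' * c)) = real p * real_of_int D'"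
          using D D' by (simp add: a' q(2) norm_mult power_mult_distrib cmod_g algebra_simps)
        then show ?thesis using q(1) p0 unfolding int_form_def f'_def
          by (intro exI[of _ a'] exI[of _ q] exI[of _ c]) auto
      qed
      moreover have "mdet (1, 0, 0, g) = g" by (simp add: mdet_def)
      then have "anisotropic f'" "separated (Gamma1 (g ^ Suc K)) f'"
        using descent_reduction[OF an' sep' refl _ _ _ _ _ pull Gamma1_conj_diag] gi by auto
      ultimately show thesis using descended D'_def by blast
    qed
  qed
qed

text \<open>Infinite descent: separation forces \<open>p\<close> to divide \<open>D\<close>, and
  \<open>D\<close> can be replaced by the smaller positive \<open>D div p\<close>. The level rises
  each time, hence the generality in \<open>K\<close>.\<close>

lemma not_separated:
  assumes "int_form f D" "anisotropic f" "D > 0" "K \<ge> 1"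
  shows "\<not> separated (Gamma1 (g ^ K)) f"
  using assms
proof (induction "nat D" arbitrary: f D K rule: less_induct)
  case less
  show ?case
  proof
    assume sep: "separated (Gamma1 (g ^ K)) f"
    have pD: "int p dvd D" using separated_imp_prime_dvd_disc less.prems sep by blast
    obtain f' where f': "int_form f' (D div int p)" "anisotropic f'" "separated (Gamma1 (g ^ Suc K)) f'"
      using descent[OF less.prems(1,2) sep pD] .
    have p1: "int p > 1" using prime prime_gt_1_nat by simp
    obtain k where k: "D = int p * k" using pD ..
    have "k > 0" using less.prems(3) p1 k by (simp add: zero_less_mult_iff)
    moreover have "k < D" using k p1 \<open>k > 0\<close> by simp
    moreover have "D div int p = k" using k p1 by simp
    ultimately show False using less.hyps[of k f' "Suc K"] f' by simp
  qed
qed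

lemma no_surface: "no_closed_embedded_tg_surface (Gamma1 g)"
  unfolding no_closed_embedded_tg_surface_def
proof (intro allI impI notI)
  fix a c :: int and B
  assume ic: "integral_circle a B c"
    and ec: "embedded_surface (Gamma1 g) (hplane a B c) \<and> closed_surface (Gamma1 g) (hplane a B c)"
  obtain D where "int_form (hform a B c) D" "D > 0"
    using integral_circle_int_form[OF ic] .
  moreover have "separated (Gamma1 (g ^ 1)) (hform a B c)"
    using ec embedded_imp_separated[OF Gamma1_subset] by simp
  moreover have "anisotropic (hform a B c)"
    using closed_surface_anisotropic[OF Gamma1_subset] ec ic by (auto simp: integral_circle_def)
  ultimately show False using not_separated by blast
qed

end

theorem theorem1p2:
  shows "(\<forall>(p::nat) g. splits_as p g \<longrightarrow>
            no_closed_embedded_tg_surface (Gamma1 g) \<and>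
            no_closed_embedded_tg_surface (Gamma1 (cnj g))) \<and>
         no_closed_embedded_tg_surface (Gamma1 (1 + \<i>))"
proof (intro conjI allI impI)
  \<comment> \<open>Conjugation makes the two divisibilities between \<open>g\<close> and
    \<open>cnj g\<close> equivalent, so both fail as soon as their conjunction does.\<close>
  have cnj_gdvd: "gdvd (cnj x) (cnj y)" if "gdvd x y" for x y
    using that unfolding gdvd_def by (metis complex_cnj_mult gauss_int_intros1(2))
  fix p g assume s: "splits_as p g"
  then have "\<not> gdvd g (cnj g)" "\<not> gdvd (cnj g) g"
    using cnj_gdvd[of g "cnj g"] cnj_gdvd[of "cnj g" g] by (auto simp: splits_as_def)
  then interpret split_prime p g + conj: split_prime p "cnj g"
    using s by unfold_locales (auto simp: splits_as_def mult.commute)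
  show "no_closed_embedded_tg_surface (Gamma1 g)" by (rule no_surface)
  show "no_closed_embedded_tg_surface (Gamma1 (cnj g))" by (rule conj.no_surface)
next
  show "no_closed_embedded_tg_surface (Gamma1 (1 + \<i>))"
    by (rule no_surface_norm_2) (auto simp: cmod_power2)
qed

end
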